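(* Let $\alpha\in(0,1]$ and let $f$ be the centred smooth stationary isotropic Gaussian field on $\mathbb{R}^2$ with covariance kernel $K(x)=\mathbb{E}[f(0)f(x)]=(1+|x|^2)^{-\alpha/2}$, whose critical level is $\ell_c=0$. Fix $\varepsilon\in(0,1/(2e))$ and, for $\ell<0$, define $$\xi(\ell)=\inf\{R\ge0:\mathbb{P}[\mathrm{Cross}_\ell(R)]<\varepsilon\},$$ where $\mathrm{Cross}_\ell(R)$ is the event that $\{f\le\ell\}\cap[0,R]^2$ contains a path that intersects both $\{0\}\times[0,R]$ and $\{R\}\times[0,R]$. Then $$\liminf_{\ell\uparrow0}\frac{-\log\xi(\ell)}{\log|\ell|}\ge\frac2\alpha.$$ In particular, if there is a constant $\nu$ such that $\xi(\ell)=|\ell|^{-\nu+o(1)}$ as $\ell\uparrow0$, then $\nu\ge2/\alpha$.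
   Context: $\{f\le\ell\}=\{x\in\mathbb{R}^2:f(x)\le\ell\}$; paths are continuous. The critical level $\ell_c$ is the level such that the probability that $\{f\le\ell\}$ contains a path between the origin and $\{|x|=R\}$ tends, as $R\to\infty$, to $0$ for $\ell<\ell_c$ and to a strictly positive limit for $\ell>\ell_c$; it is known that $\ell_c=0$ for these fields. *)

theory Defs
  imports "HOL-Probability.Probability"
begin

text \<open>A real random variable is Gaussian if it is normally distributed; the degenerate case of an
  almost surely constant variable (variance zero) is included, as is needed for the linear
  combinations of a Gaussian field.\<close>

definition gaussian_rv :: "'w measure \<Rightarrow> ('w \<Rightarrow> real) \<Rightarrow> bool" where
  "gaussian_rv M X \<longleftrightarrow> X \<in> borel_measurable M \<and>
     (\<exists>\<mu> \<sigma>. (\<sigma> = 0 \<and> (AE \<omega> in M. X \<omega> = \<mu>)) \<or>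
            (\<sigma> > 0 \<and> distributed M lborel X (normal_density \<mu> \<sigma>)))"

definition gaussian_field :: "'w measure \<Rightarrow> (real^2 \<Rightarrow> 'w \<Rightarrow> real) \<Rightarrow> bool" where
  "gaussian_field M f \<longleftrightarrow>
     (\<forall>S c. finite S \<longrightarrow> gaussian_rv M (\<lambda>\<omega>. \<Sum>x\<in>S. c x * f x \<omega>))"

definition centred_field :: "'w measure \<Rightarrow> (real^2 \<Rightarrow> 'w \<Rightarrow> real) \<Rightarrow> bool" where
  "centred_field M f \<longleftrightarrow> (\<forall>x. (LINT \<omega>|M. f x \<omega>) = 0)"

text \<open>The law of a field on the product sigma-algebra, which encodes exactly its
  finite-dimensional distributions.\<close>

definition field_law :: "'w measure \<Rightarrow> (real^2 \<Rightarrow> 'w \<Rightarrow> real) \<Rightarrow> (real^2 \<Rightarrow> real) measure" where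
  "field_law M f = distr M (\<Pi>\<^sub>M x\<in>UNIV. borel) (\<lambda>\<omega> x. f x \<omega>)"

definition stationary_field :: "'w measure \<Rightarrow> (real^2 \<Rightarrow> 'w \<Rightarrow> real) \<Rightarrow> bool" where
  "stationary_field M f \<longleftrightarrow> (\<forall>a. field_law M (\<lambda>x. f (x + a)) = field_law M f)"

definition isotropic_field :: "'w measure \<Rightarrow> (real^2 \<Rightarrow> 'w \<Rightarrow> real) \<Rightarrow> bool" where
  "isotropic_field M f \<longleftrightarrow>
     (\<forall>Q :: real^2^2. rotation_matrix Q \<longrightarrow> field_law M (\<lambda>x. f (Q *v x)) = field_law M f)"

text \<open>\<open>k\<close> times continuously differentiable on the whole plane: the derivative in every direction
  is \<open>k - 1\<close> times continuously differentiable.\<close>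

primrec Ck :: "nat \<Rightarrow> (real^2 \<Rightarrow> real) \<Rightarrow> bool" where
  "Ck 0 g \<longleftrightarrow> continuous_on UNIV g"
| "Ck (Suc k) g \<longleftrightarrow> (\<forall>x. g differentiable (at x)) \<and>
     (\<forall>v. Ck k (\<lambda>x. frechet_derivative g (at x) v))"

definition smooth_field :: "'w measure \<Rightarrow> (real^2 \<Rightarrow> 'w \<Rightarrow> real) \<Rightarrow> bool" where
  "smooth_field M f \<longleftrightarrow> (AE \<omega> in M. \<forall>k. Ck k (\<lambda>x. f x \<omega>))"

definition cauchy_kernel :: "real \<Rightarrow> real^2 \<Rightarrow> real" where
  "cauchy_kernel \<alpha> x = (1 + (norm x)\<^sup>2) powr (- \<alpha> / 2)"

text \<open>Paths need not be injective and may be constant; at \<open>R = 0\<close> the square and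
  both of its sides are the origin.\<close>

definition Cross :: "'w measure \<Rightarrow> (real^2 \<Rightarrow> 'w \<Rightarrow> real) \<Rightarrow> real \<Rightarrow> real \<Rightarrow> 'w set" where
  "Cross M f l R = {\<omega> \<in> space M. \<exists>\<gamma> :: real \<Rightarrow> real^2. path \<gamma> \<and>
     path_image \<gamma> \<subseteq> {x. f x \<omega> \<le> l} \<inter> {x. x$1 \<in> {0..R} \<and> x$2 \<in> {0..R}} \<and>
     path_image \<gamma> \<inter> {x. x$1 = 0 \<and> x$2 \<in> {0..R}} \<noteq> {} \<and>
     path_image \<gamma> \<inter> {x. x$1 = R \<and> x$2 \<in> {0..R}} \<noteq> {}}"

text \<open>The crossing event quantifies over uncountably many paths and the field is only almost surely
  smooth, so it belongs to the sigma-algebra of \<open>M\<close> only up to null sets; its probability is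
  therefore taken in the completion of \<open>M\<close>.  The infimum is taken in the extended reals, so that the infimum of
  the empty set is \<open>\<infinity>\<close>.\<close>

definition xi :: "'w measure \<Rightarrow> (real^2 \<Rightarrow> 'w \<Rightarrow> real) \<Rightarrow> real \<Rightarrow> real \<Rightarrow> ereal" where
  "xi M f \<epsilon> l = Inf {ereal R | R. R \<ge> 0 \<and> measure (completion M) (Cross M f l R) < \<epsilon>}"

text \<open>The logarithm from \<open>[0, \<infinity>]\<close> to \<open>[-\<infinity>, \<infinity>]\<close>.\<close>

definition ln_ereal :: "ereal \<Rightarrow> ereal" where
  "ln_ereal x = (if x \<le> 0 then - \<infinity> else if x = \<infinity> then \<infinity> else ereal (ln (real_of_ereal x)))"

end

theory Submission
  imports Defs "HOL-Real_Asymp.Real_Asymp"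
begin

text \<open>
  For a continuous function \<open>u\<close> on the square let \<open>T(u)\<close> be the smallest level that a crossing can
  achieve: the infimum, over all left-right crossings, of the maximum of \<open>u\<close> along the crossing.
  Up to null sets \<open>Cross\<close> at level \<open>l\<close> lies between \<open>T(f) < l\<close> and \<open>T(f) \<le> l\<close>, so everything reduces to
  the law of the one real random variable \<open>T(f)\<close>.  Two facts about it suffice.

  \<^emph>\<open>Its median is at most \<open>0\<close>.\<close>  By planar duality, proved here with Brouwer's fixed point theorem,
  either \<open>u\<close> is crossed from left to right at level \<open>0\<close>, or \<open>-u\<close> is crossed from bottom to top; and
  reflecting the square in its diagonal and negating \<open>f\<close> does not change the law of \<open>f\<close>
  (\<open>minimax_duality\<close>, \<open>prob_crossing_level_nonpos\<close>).

  \<^emph>\<open>It is spread out.\<close>  Let \<open>Z\<close> be the average of \<open>f\<close> over the first \<open>n\<close> integer points of the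
  first axis, where \<open>n\<close> is just large enough for them to reach along the bottom side of the square.  Then \<open>f = g + \<kappa> Z\<close>, where \<open>g\<close> is independent of \<open>Z\<close> and
  \<open>\<kappa>(x) = E[Z f(x)] / E[Z\<^sup>2]\<close>.  If \<open>E[Z f(x)] \<ge> m > 0\<close> on the square, then for fixed \<open>g\<close> the
  value \<open>T(g + \<kappa> z)\<close> grows at least at rate \<open>m / E[Z\<^sup>2]\<close> in \<open>z\<close>.  Since \<open>Z\<close> has a bounded density,
  \<open>T(f)\<close> lies in an interval of length \<open>h\<close> with probability at most \<open>h * sqrt (E[Z\<^sup>2]) / m\<close>
  (\<open>prob_crossing_level_interval\<close>).

  Together they bound the crossing probability at level \<open>l < 0\<close> below by
  \<open>1/2 - \<bar>l\<bar> * sqrt (E[Z\<^sup>2]) / m\<close>.  The covariance decays like \<open>R\<^sup>-\<^sup>\<alpha>\<close>; so \<open>m\<close> is of order \<open>R\<^sup>-\<^sup>\<alpha>\<close>, and \<open>E[Z\<^sup>2]\<close>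
  is of the same order up to a logarithm.  The error term is thus about \<open>\<bar>l\<bar> R powr (\<alpha>/2)\<close>, up to a
  power of a logarithm, which is small as long as \<open>R \<le> \<bar>l\<bar> powr (-q)\<close> with \<open>q < 2/\<alpha>\<close>.  Hence
  \<open>xi\<close> is eventually at least \<open>\<bar>l\<bar> powr (-q)\<close> for each such \<open>q\<close>, which is the claim.

  The one tool of a general nature is that the law of a field is determined by the characteristic
  functions of its finite linear combinations (\<open>field_law_unique\<close>).  It gives the reflection symmetry
  and, in place of a theory of conditional Gaussian laws, the independence of \<open>g\<close> and \<open>Z\<close>.
\<close>

section \<open>Crossings of a square\<close>

definition square :: "real \<Rightarrow> (real^2) set" where
  "square R = {x. x$1 \<in> {0..R} \<and> x$2 \<in> {0..R}}"

text \<open>Only the images of the crossing paths matter.  A crossing meets the two vertical sides anywhere along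
  the path; the endpoints need not lie on them.\<close>

definition crossings :: "real \<Rightarrow> (real^2) set set" where
  "crossings R = {path_image \<gamma> |\<gamma>. path \<gamma> \<and> path_image \<gamma> \<subseteq> square R \<and>
     (\<exists>x\<in>path_image \<gamma>. x$1 = 0) \<and> (\<exists>x\<in>path_image \<gamma>. x$1 = R)}"

definition swap :: "real^2 \<Rightarrow> real^2" where
  "swap x = (\<chi> i. if i = 1 then x$2 else x$1)"

lemma square_cbox: "square R = cbox 0 (\<chi> i. R)"
  by (auto simp: square_def cbox_def Basis_vec_def inner_axis forall_2)

lemma swap_nth [simp]: "swap x $ 1 = x $ 2" "swap x $ 2 = x $ 1"
  by (simp_all add: swap_def)

lemma swap_swap [simp]: "swap (swap x) = x"
  by (simp add: vec_eq_iff forall_2)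

lemma swap_in_square [simp]: "swap x \<in> square R \<longleftrightarrow> x \<in> square R"
  by (auto simp: square_def)

lemma continuous_on_swap: "continuous_on S swap"
proof -
  have "continuous_on S (\<lambda>x::real^2. if i = 1 then x$2 else x$1)" for i :: 2
    by (cases "i = 1") (auto intro!: continuous_on_component continuous_on_id)
  thus ?thesis unfolding swap_def by (rule continuous_on_vec_lambda)
qed

section \<open>Minimax values\<close>

definition minimax :: "'a set set \<Rightarrow> ('a \<Rightarrow> real) \<Rightarrow> real" where
  "minimax \<C> u = (INF A\<in>\<C>. SUP x\<in>A. u x)"

lemma bdd_above_image_subset:
  fixes u :: "'a \<Rightarrow> real"
  assumes "bounded (u ` S)" "A \<subseteq> S"
  shows "bdd_above (u ` A)"
  using bounded_subset[OF assms(1) image_mono[OF assms(2)]] by (rule bounded_imp_bdd_above)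

text \<open>The elementary theory of minimax values works for any nonempty family of nonempty subsets of a
  set on which the functions are bounded.\<close>

locale crossing_family =
  fixes \<C> :: "'a set set" and S :: "'a set"
  assumes ne: "\<C> \<noteq> {}" and mem: "A \<in> \<C> \<Longrightarrow> A \<noteq> {} \<and> A \<subseteq> S"
begin

lemma bdd_below_sup:
  fixes u :: "'a \<Rightarrow> real"
  assumes "bounded (u ` S)"
  shows "bdd_below ((\<lambda>A. SUP x\<in>A. u x) ` \<C>)"
proof -
  obtain K where K: "\<And>x. x \<in> S \<Longrightarrow> K \<le> u x"
    using bounded_imp_bdd_below[OF assms] by (auto simp: bdd_below_def)
  have "K \<le> (SUP x\<in>A. u x)" if A: "A \<in> \<C>" for A
  proof -
    obtain x where x: "x \<in> A" using mem[OF A] by blast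
    with A have "K \<le> u x" using K mem by blast
    also have "\<dots> \<le> (SUP x\<in>A. u x)"
      using bdd_above_image_subset[OF assms] mem[OF A] x by (intro cSUP_upper) auto
    finally show ?thesis .
  qed
  thus ?thesis by (auto simp: bdd_below_def)
qed

lemma minimax_le:
  assumes "bounded (u ` S)" "A \<in> \<C>" "\<And>x. x \<in> A \<Longrightarrow> u x \<le> l"
  shows "minimax \<C> u \<le> l"
proof -
  have "minimax \<C> u \<le> (SUP x\<in>A. u x)"
    unfolding minimax_def by (intro cINF_lower bdd_below_sup assms)
  also have "\<dots> \<le> l" using mem[OF assms(2)] assms(3) by (intro cSUP_least) auto
  finally show ?thesis .
qed

lemma minimax_less:
  assumes "bounded (u ` S)" "minimax \<C> u < l"
  obtains A where "A \<in> \<C>" "\<And>x. x \<in> A \<Longrightarrow> u x < l"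
proof -
  obtain A where A: "A \<in> \<C>" "(SUP x\<in>A. u x) < l"
    using assms cINF_less_iff[OF ne bdd_below_sup[OF assms(1)]] unfolding minimax_def by blast
  have "u x < l" if "x \<in> A" for x
    using A bdd_above_image_subset[OF assms(1)] mem[OF A(1)] that cSUP_upper[of x A u] by fastforce
  thus ?thesis using that A by blast
qed

text \<open>Monotonicity and Lipschitz continuity in one statement.  A negative \<open>d\<close> gives the strict growth
  of the minimax value under a shift that is bounded below, which is how the field average acts on it.\<close>

lemma minimax_mono_shift:
  assumes "bounded (u ` S)" "bounded (v ` S)" "\<And>x. x \<in> S \<Longrightarrow> v x \<le> u x + d"
  shows "minimax \<C> v \<le> minimax \<C> u + d"
proof (rule field_le_epsilon)
  fix e :: real assume "e > 0"
  hence "minimax \<C> u < minimax \<C> u + e" by simp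
  then obtain A where A: "A \<in> \<C>" "\<And>x. x \<in> A \<Longrightarrow> u x < minimax \<C> u + e"
    using minimax_less[OF assms(1)] by blast
  have "v x \<le> minimax \<C> u + d + e" if "x \<in> A" for x
  proof -
    have "x \<in> S" using mem[OF A(1)] that by blast
    thus ?thesis using A(2)[OF that] assms(3)[of x] by linarith
  qed
  thus "minimax \<C> v \<le> minimax \<C> u + d + e" by (rule minimax_le[OF assms(2) A(1)])
qed

text \<open>After precomposition with a map of finite range only finitely many values of \<open>u\<close> count, and the
  minimax is a genuine minimum of maxima; this makes it measurable in those values.\<close>

lemma minimax_finite_range:
  assumes "finite (r ` S)"
  shows "minimax \<C> (\<lambda>x. u (r x)) = Min ((\<lambda>B. Max (u ` B)) ` ((`) r ` \<C>))"
proof -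
  have fin: "finite (r ` A)" "r ` A \<noteq> {}" if "A \<in> \<C>" for A
    using mem[OF that] finite_subset[OF image_mono assms] by auto
  have "(`) r ` \<C> \<subseteq> Pow (r ` S)" using mem by blast
  hence "finite ((`) r ` \<C>)" using assms finite_subset by blast
  have "(\<lambda>A. SUP x\<in>A. u (r x)) ` \<C> = (\<lambda>B. Max (u ` B)) ` ((`) r ` \<C>)"
    unfolding image_image
  proof (rule image_cong[OF refl])
    fix A assume "A \<in> \<C>"
    from fin[OF this] show "(SUP x\<in>A. u (r x)) = (MAX x\<in>A. u (r x))"
      by (subst cSup_eq_Max) (auto simp: image_image[symmetric])
  qed
  thus ?thesis unfolding minimax_def
    using \<open>finite ((`) r ` \<C>)\<close> ne by (simp add: cInf_eq_Min)
qed

end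

lemma crossing_family_crossings:
  assumes "R \<ge> 0"
  shows "crossing_family (crossings R) (square R)"
proof
  define e :: "real^2" where "e = (\<chi> i. if i = 1 then R else 0)"
  have e: "e$1 = R" "e$2 = 0" by (simp_all add: e_def)
  have "closed_segment 0 e \<subseteq> square R"
  proof (rule closed_segment_subset)
    show "0 \<in> square R" "e \<in> square R" using assms e by (simp_all add: square_def)
    show "convex (square R)" by (simp add: square_cbox)
  qed
  moreover have "0 \<in> closed_segment 0 e" "e \<in> closed_segment 0 e" by simp_all
  ultimately have "path_image (linepath 0 e) \<in> crossings R"
    unfolding crossings_def using e(1)
    by (intro CollectI exI[of _ "linepath 0 e"]) (force simp del: ends_in_segment)
  thus "crossings R \<noteq> {}" by blast
next
  fix A assume "A \<in> crossings R"
  thus "A \<noteq> {} \<and> A \<subseteq> square R" by (auto simp: crossings_def)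
qed

section \<open>Planar duality\<close>

lemma bounded_continuous_square:
  fixes u :: "real^2 \<Rightarrow> real"
  assumes "continuous_on (square R) u"
  shows "bounded (u ` square R)"
  using assms by (intro compact_imp_bounded compact_continuous_image) (auto simp: square_cbox)

text \<open>The function \<open>a\<close> is the excess \<open>max 0 (\<delta> - w)\<close>, with positive sign on the points of \<open>{w < \<delta>}\<close>
  that are path connected to \<open>L\<close> and negative sign elsewhere.  It stays continuous because the sign
  is locally constant on \<open>{w < \<delta>}\<close>, where small pieces of the convex set \<open>S\<close> are path connected, and
  because the excess vanishes where \<open>{w < \<delta>}\<close> ends.\<close>

lemma signed_excess:
  fixes w :: "'a::real_normed_vector \<Rightarrow> real" and \<delta> :: real
  assumes w: "continuous_on S w" and "convex S" and "L \<subseteq> S"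
  obtains a where "continuous_on S a"
    and "\<And>x. x \<in> S \<Longrightarrow> \<bar>a x\<bar> = max 0 (\<delta> - w x)"
    and "\<And>x. x \<in> S \<Longrightarrow> a x > 0 \<Longrightarrow> \<exists>y\<in>L. path_component {x \<in> S. w x < \<delta>} y x"
    and "\<And>x. x \<in> S \<Longrightarrow> a x < 0 \<Longrightarrow> x \<notin> L"
proof
  let ?A = "{x \<in> S. w x < \<delta>}"
  let ?r = "\<lambda>x. \<exists>y\<in>L. path_component ?A y x"
  let ?e = "\<lambda>x. max 0 (\<delta> - w x)"
  define a where "a x = (if ?r x then ?e x else - ?e x)" for x
  have e: "continuous_on S ?e"
    by (intro continuous_intros w)
  show abs: "\<bar>a x\<bar> = max 0 (\<delta> - w x)" if "x \<in> S" for x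
    by (simp add: a_def)
  show "\<exists>y\<in>L. path_component ?A y x" if "x \<in> S" "a x > 0" for x
    using that by (auto simp: a_def split: if_splits)
  show "x \<notin> L" if "x \<in> S" "a x < 0" for x
  proof
    assume "x \<in> L"
    with that have "?r x"
      by (intro bexI[of _ x] path_component_refl) (auto simp: a_def split: if_splits)
    with that show False by (simp add: a_def)
  qed
  show "continuous_on S a"
    unfolding continuous_on_def
  proof
    fix x assume x: "x \<in> S"
    show "(a \<longlongrightarrow> a x) (at x within S)"
    proof (cases "w x < \<delta>")
      case False
      hence 0: "?e x = 0" by simp
      have "(?e \<longlongrightarrow> 0) (at x within S)"
        using e x 0 unfolding continuous_on_def by metis
      hence "(a \<longlongrightarrow> 0) (at x within S)"
        by (rule Lim_null_comparison[rotated]) (auto simp: a_def)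
      thus ?thesis using 0 by (simp add: a_def)
    next
      case True
      from w x have "(w \<longlongrightarrow> w x) (at x within S)" by (simp add: continuous_on_def)
      hence "\<forall>\<^sub>F y in at x within S. w y < \<delta>" using True by (rule order_tendstoD)
      then obtain d where d: "d > 0" "\<And>y. y \<in> S \<Longrightarrow> y \<noteq> x \<Longrightarrow> dist y x < d \<Longrightarrow> w y < \<delta>"
        unfolding eventually_at by auto
      have conn: "path_component ?A x y" if "y \<in> S" "dist y x < d" for y
      proof -
        have "convex (S \<inter> ball x d)" by (intro convex_Int assms convex_ball)
        hence "path_connected (S \<inter> ball x d)" by (rule convex_imp_path_connected)
        moreover have "x \<in> S \<inter> ball x d" "y \<in> S \<inter> ball x d" using x d that by (auto simp: dist_commute)
        ultimately have "path_component (S \<inter> ball x d) x y"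
          unfolding path_connected_component by blast
        moreover have "S \<inter> ball x d \<subseteq> ?A" using d True by (force simp: dist_commute)
        ultimately show ?thesis using path_component_of_subset by blast
      qed
      have r: "?r y = ?r x" if "y \<in> S" "dist y x < d" for y
        using conn[OF that] by (meson path_component_sym path_component_trans)
      define s :: real where "s = (if ?r x then 1 else -1)"
      have "((\<lambda>y. s * ?e y) \<longlongrightarrow> s * ?e x) (at x within S)"
        by (intro tendsto_mult tendsto_const) (use e x in \<open>simp add: continuous_on_def\<close>)
      moreover have "a y = s * ?e y" if "y \<in> S" "dist y x < d" for y
        using r[OF that] by (simp add: a_def s_def)
      ultimately show ?thesis
        using d(1) x
        by (subst tendsto_cong[where g="\<lambda>y. s * ?e y"]) (auto simp: eventually_at intro!: exI[of _ d])
    qed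
  qed
qed

text \<open>Suppose the square is displaced by the vector field \<open>(a, b)\<close>, where \<open>a\<close> is the signed excess of
  \<open>u\<close> with respect to the left side and \<open>b\<close> that of \<open>-u\<close> with respect to the bottom side, and then
  clamped back to the square.  The field never vanishes, because \<open>u < \<delta>\<close> or \<open>-u < \<delta>\<close> at each point.
  So at a Brouwer fixed point the displacement pushes against a side: \<open>a > 0\<close> on the right side
  yields a crossing of \<open>{u < \<delta>}\<close>, and \<open>b > 0\<close> on the top side a vertical crossing of \<open>{-u < \<delta>}\<close>.
  The other two directions are impossible, since points of the left or bottom side carry the
  positive sign.\<close>

lemma crossing_duality:
  fixes u :: "real^2 \<Rightarrow> real"
  assumes u: "continuous_on (square R) u" and "R \<ge> 0" and "\<delta> > 0"
  shows "(\<exists>A\<in>crossings R. \<forall>x\<in>A. u x < \<delta>) \<or> (\<exists>A\<in>crossings R. \<forall>x\<in>A. - u (swap x) < \<delta>)"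
proof -
  let ?S = "square R"
  have S: "convex ?S" "compact ?S" "?S \<noteq> {}"
    using \<open>R \<ge> 0\<close> by (auto simp: square_cbox interval_ne_empty_cart)
  obtain a where a: "continuous_on ?S a"
    "\<And>x. x \<in> ?S \<Longrightarrow> \<bar>a x\<bar> = max 0 (\<delta> - u x)"
    "\<And>x. x \<in> ?S \<Longrightarrow> a x > 0 \<Longrightarrow> \<exists>y\<in>{y\<in>?S. y$1 = 0}. path_component {x \<in> ?S. u x < \<delta>} y x"
    "\<And>x. x \<in> ?S \<Longrightarrow> a x < 0 \<Longrightarrow> x \<notin> {y\<in>?S. y$1 = 0}"
    using signed_excess[of ?S u "{y\<in>?S. y$1 = 0}" \<delta>] u S by blast
  have "continuous_on ?S (\<lambda>x. - u x)" by (intro continuous_intros u)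
  then obtain b where b: "continuous_on ?S b"
    "\<And>x. x \<in> ?S \<Longrightarrow> \<bar>b x\<bar> = max 0 (\<delta> - - u x)"
    "\<And>x. x \<in> ?S \<Longrightarrow> b x > 0 \<Longrightarrow> \<exists>y\<in>{y\<in>?S. y$2 = 0}. path_component {x \<in> ?S. - u x < \<delta>} y x"
    "\<And>x. x \<in> ?S \<Longrightarrow> b x < 0 \<Longrightarrow> x \<notin> {y\<in>?S. y$2 = 0}"
    using signed_excess[of ?S "\<lambda>x. - u x" "{y\<in>?S. y$2 = 0}" \<delta>] S by blast
  define h :: "real^2 \<Rightarrow> real^2" where
    "h x = (\<chi> i. max 0 (min R (x$i + (if i = 1 then a x else b x))))" for x
  have "continuous_on ?S h"
    unfolding h_def
  proof (rule continuous_on_vec_lambda)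
    fix i :: 2
    show "continuous_on ?S (\<lambda>x. max 0 (min R (x$i + (if i = 1 then a x else b x))))"
      using a(1) b(1) by (cases "i = 1") (auto intro!: continuous_intros continuous_on_component)
  qed
  moreover have "h \<in> ?S \<rightarrow> ?S"
    using \<open>R \<ge> 0\<close> by (auto simp: h_def square_def)
  ultimately obtain x where x: "x \<in> ?S" "h x = x"
    using brouwer[OF S(2,1,3)] by blast
  have x1: "x$1 = max 0 (min R (x$1 + a x))" and x2: "x$2 = max 0 (min R (x$2 + b x))"
    using x(2) by (auto simp: h_def vec_eq_iff forall_2)
  have "a x \<noteq> 0 \<or> b x \<noteq> 0"
    using a(2)[OF x(1)] b(2)[OF x(1)] \<open>\<delta> > 0\<close> by (auto simp: max_def split: if_splits)
  moreover have "\<not> a x < 0" using a(4)[OF x(1)] x1 x(1) by (auto simp: max_def min_def square_def split: if_splits)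
  moreover have "\<not> b x < 0" using b(4)[OF x(1)] x2 x(1) by (auto simp: max_def min_def square_def split: if_splits)
  ultimately consider "a x > 0" | "b x > 0" by linarith
  thus ?thesis
  proof cases
    case 1
    then obtain y where y: "y \<in> ?S" "y$1 = 0" "path_component {x \<in> ?S. u x < \<delta>} y x"
      using a(3)[OF x(1)] by blast
    have "x$1 = R" using 1 x1 x(1) by (auto simp: max_def min_def square_def split: if_splits)
    obtain \<gamma> where g: "path \<gamma>" "path_image \<gamma> \<subseteq> {x \<in> ?S. u x < \<delta>}" "pathstart \<gamma> = y" "pathfinish \<gamma> = x"
      using y(3) unfolding path_component_def by blast
    have "path_image \<gamma> \<in> crossings R"
      using g y \<open>x$1 = R\<close> unfolding crossings_def
      by (blast intro: pathstart_in_path_image pathfinish_in_path_image)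
    thus ?thesis using g by blast
  next
    case 2
    then obtain y where y: "y \<in> ?S" "y$2 = 0" "path_component {x \<in> ?S. - u x < \<delta>} y x"
      using b(3)[OF x(1)] by blast
    have "x$2 = R" using 2 x2 x(1) by (auto simp: max_def min_def square_def split: if_splits)
    obtain \<gamma> where g: "path \<gamma>" "path_image \<gamma> \<subseteq> {x \<in> ?S. - u x < \<delta>}" "pathstart \<gamma> = y" "pathfinish \<gamma> = x"
      using y(3) unfolding path_component_def by blast
    let ?\<gamma> = "swap \<circ> \<gamma>"
    have im: "path_image ?\<gamma> = swap ` path_image \<gamma>" by (simp add: path_image_compose)
    have "y \<in> path_image \<gamma>" "x \<in> path_image \<gamma>"
      using g by (auto intro: pathstart_in_path_image pathfinish_in_path_image)
    hence "path_image ?\<gamma> \<in> crossings R"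
      using g y \<open>x$2 = R\<close> unfolding crossings_def
      by (intro CollectI exI[of _ ?\<gamma>]) (auto simp: im intro!: path_continuous_image continuous_on_swap)
    moreover have "\<forall>x\<in>path_image ?\<gamma>. - u (swap x) < \<delta>" using g by (auto simp: im)
    ultimately show ?thesis by blast
  qed
qed

text \<open>The limit of \<open>crossing_duality\<close> as the margin tends to zero: for minimax values no margin is left.\<close>

lemma minimax_duality:
  fixes u :: "real^2 \<Rightarrow> real"
  assumes R: "R \<ge> 0" and u: "continuous_on (square R) u"
  shows "minimax (crossings R) u \<le> 0 \<or> minimax (crossings R) (\<lambda>x. - u (swap x)) \<le> 0"
proof (rule ccontr)
  interpret crossing_family "crossings R" "square R" by (rule crossing_family_crossings[OF R])
  let ?v = "\<lambda>x. - u (swap x)"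
  have b: "bounded (u ` square R)" by (rule bounded_continuous_square[OF u])
  have "bounded (uminus ` u ` square R)" using b by simp
  hence b': "bounded (?v ` square R)"
    by (rule bounded_subset) (force simp: image_iff)
  assume "\<not> ?thesis"
  hence pos: "minimax (crossings R) u > 0" "minimax (crossings R) ?v > 0" by auto
  \<comment> \<open>Strictly below both values, since a crossing at level \<open>\<delta>\<close> only bounds the minimax by \<open>\<delta>\<close>.\<close>
  define \<delta> where "\<delta> = min (minimax (crossings R) u) (minimax (crossings R) ?v) / 2"
  have \<delta>: "\<delta> > 0" "\<delta> < minimax (crossings R) u" "\<delta> < minimax (crossings R) ?v"
    using pos by (auto simp: \<delta>_def min_def)
  from crossing_duality[OF u R \<delta>(1)] show False
  proof (elim disjE bexE)
    fix A assume "A \<in> crossings R" "\<forall>x\<in>A. u x < \<delta>"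
    hence "minimax (crossings R) u \<le> \<delta>" by (intro minimax_le[OF b, of A]) auto
    thus False using \<delta> by simp
  next
    fix A assume "A \<in> crossings R" "\<forall>x\<in>A. - u (swap x) < \<delta>"
    hence "minimax (crossings R) ?v \<le> \<delta>" by (intro minimax_le[OF b', of A]) auto
    thus False using \<delta> by simp
  qed
qed

section \<open>Measurability of the minimax crossing level\<close>

definition grid :: "nat \<Rightarrow> real^2 \<Rightarrow> real^2" where
  "grid n x = (\<chi> i. of_int \<lfloor>real (Suc n) * x$i\<rfloor> / real (Suc n))"

lemma grid_in_square:
  assumes "x \<in> square R"
  shows "grid n x \<in> square R"
proof -
  have "of_int \<lfloor>real (Suc n) * x$i\<rfloor> / real (Suc n) \<le> x$i" for i
    using of_int_floor_le[of "real (Suc n) * x$i"] by (simp add: divide_le_eq mult.commute)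
  moreover have "x$i \<ge> 0 \<Longrightarrow> of_int \<lfloor>real (Suc n) * x$i\<rfloor> / real (Suc n) \<ge> 0" for i
    by simp
  ultimately show ?thesis using assms unfolding square_def grid_def
    by (fastforce intro: order_trans)
qed

lemma finite_grid_image: "finite (grid n ` square R)"
proof -
  let ?I = "{0..\<lfloor>real (Suc n) * R\<rfloor>}"
  let ?v = "\<lambda>(a, b). \<chi> i::2. (if i = 1 then of_int a else of_int b) / real (Suc n)"
  have "grid n ` square R \<subseteq> ?v ` (?I \<times> ?I)"
  proof safe
    fix x assume x: "x \<in> square R"
    have "\<lfloor>real (Suc n) * x$i\<rfloor> \<in> ?I" for i
      using x exhaust_2[of i] by (auto simp: square_def intro!: floor_mono mult_left_mono)
    moreover have "grid n x = ?v (\<lfloor>real (Suc n) * x$1\<rfloor>, \<lfloor>real (Suc n) * x$2\<rfloor>)"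
      by (simp add: grid_def vec_eq_iff forall_2)
    ultimately show "grid n x \<in> ?v ` (?I \<times> ?I)" by blast
  qed
  thus ?thesis by (rule finite_subset) auto
qed

lemma dist_grid: "dist (grid n x) x \<le> 2 / real (Suc n)"
proof -
  have c: "\<bar>grid n x $ i - x$i\<bar> \<le> 1 / real (Suc n)" for i
  proof -
    have "grid n x $ i - x$i = (of_int \<lfloor>real (Suc n) * x$i\<rfloor> - real (Suc n) * x$i) / real (Suc n)"
      by (simp add: grid_def diff_divide_distrib)
    also have "\<bar>\<dots>\<bar> \<le> 1 / real (Suc n)"
      unfolding abs_divide by (rule frac_le) linarith+
    finally show ?thesis .
  qed
  have "dist (grid n x) x \<le> (\<Sum>i\<in>UNIV. \<bar>(grid n x - x) $ i\<bar>)"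
    unfolding dist_norm by (rule norm_le_l1_cart)
  also have "\<dots> = \<bar>grid n x $ 1 - x$1\<bar> + \<bar>grid n x $ 2 - x$2\<bar>" by (simp add: sum_2)
  also have "\<dots> \<le> 1 / real (Suc n) + 1 / real (Suc n)" by (intro add_mono c)
  finally show ?thesis by simp
qed

text \<open>This is the minimax value written as a limit of functions of finitely many values of \<open>v\<close>.  In
  this form it is a measurable functional on the product space of all functions, so it depends only on
  the law of a field; \<open>lim\<close> has an arbitrary value at functions for which there is no limit.\<close>

definition crossing_level :: "real \<Rightarrow> (real^2 \<Rightarrow> real) \<Rightarrow> real" where
  "crossing_level R v = lim (\<lambda>n. minimax (crossings R) (\<lambda>x. v (grid n x)))"

text \<open>Rounding moves points by at most \<open>2 / (n + 1)\<close>, so by uniform continuity \<open>u\<close> composed with the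
  rounding converges uniformly to \<open>u\<close>, and minimax values are Lipschitz in the uniform norm.\<close>

lemma crossing_level_eq_minimax:
  assumes R: "R \<ge> 0" and u: "continuous_on (square R) u"
  shows "crossing_level R u = minimax (crossings R) u"
  unfolding crossing_level_def
proof (rule limI, rule LIMSEQ_I)
  interpret crossing_family "crossings R" "square R" by (rule crossing_family_crossings[OF R])
  fix e :: real assume e: "e > 0"
  have "uniformly_continuous_on (square R) u"
    by (intro compact_uniformly_continuous u) (simp add: square_cbox)
  then obtain d where d: "d > 0"
    "\<And>x y. x \<in> square R \<Longrightarrow> y \<in> square R \<Longrightarrow> dist y x < d \<Longrightarrow> dist (u y) (u x) < e/2"
    unfolding uniformly_continuous_on_def using e by (meson half_gt_zero)
  obtain N :: nat where N: "2 / d < real N" using reals_Archimedean2 by blast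
  have "norm (minimax (crossings R) (\<lambda>x. u (grid n x)) - minimax (crossings R) u) < e" if "n \<ge> N" for n
  proof -
    have "2 / d < real (Suc n)" using N that by linarith
    hence "2 / real (Suc n) < d" using d(1) by (simp add: field_simps)
    hence "dist (grid n x) x < d" for x using dist_grid[of n x] by linarith
    hence *: "\<bar>u (grid n x) - u x\<bar> < e/2" if "x \<in> square R" for x
      using d(2)[OF that grid_in_square[OF that]] by (simp add: dist_real_def)
    have le: "u (grid n x) \<le> u x + e/2" "u x \<le> u (grid n x) + e/2" if "x \<in> square R" for x
      using *[OF that] by linarith+
    have b: "bounded (u ` square R)" by (rule bounded_continuous_square[OF u])
    have b': "bounded ((\<lambda>x. u (grid n x)) ` square R)"
      by (rule bounded_subset[OF b]) (auto intro: grid_in_square)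
    have "minimax (crossings R) (\<lambda>x. u (grid n x)) \<le> minimax (crossings R) u + e/2"
      by (intro minimax_mono_shift b b') (rule le)
    moreover have "minimax (crossings R) u \<le> minimax (crossings R) (\<lambda>x. u (grid n x)) + e/2"
      by (intro minimax_mono_shift b b') (rule le)
    ultimately show ?thesis using e by (simp add: abs_less_iff)
  qed
  thus "\<exists>N. \<forall>n\<ge>N. norm (minimax (crossings R) (\<lambda>x. u (grid n x)) - minimax (crossings R) u) < e"
    by blast
qed

lemma measurable_crossing_level:
  assumes R: "R \<ge> 0"
  shows "crossing_level R \<in> borel_measurable (\<Pi>\<^sub>M x\<in>UNIV. borel)"
proof -
  interpret crossing_family "crossings R" "square R" by (rule crossing_family_crossings[OF R])
  have fin: "finite (grid n ` A)" if "A \<in> crossings R" for A n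
    using mem[OF that] finite_subset[OF image_mono finite_grid_image] by blast
  have "finite ((`) (grid n) ` crossings R)" for n
  proof (rule finite_subset)
    show "(`) (grid n) ` crossings R \<subseteq> Pow (grid n ` square R)" using mem by blast
  qed (simp add: finite_grid_image)
  hence "(\<lambda>v. minimax (crossings R) (\<lambda>x. v (grid n x))) \<in> borel_measurable (\<Pi>\<^sub>M x\<in>UNIV. borel)" for n
    unfolding minimax_finite_range[OF finite_grid_image]
  proof (intro borel_measurable_Min)
    fix B assume "B \<in> (`) (grid n) ` crossings R"
    hence "finite B" using fin by blast
    thus "(\<lambda>v. Max (v ` B)) \<in> borel_measurable (\<Pi>\<^sub>M x\<in>UNIV. borel :: real measure)"
      by (intro borel_measurable_Max measurable_component_singleton) auto
  qed
  thus ?thesis unfolding crossing_level_def by (rule borel_measurable_lim_metric)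
qed

section \<open>The law of a field is determined by its linear combinations\<close>

text \<open>Characteristic functions enter below only through real cosines with a phase, so that they can be
  combined with real weights; this lemma is the link to the complex function \<open>char\<close>.\<close>

lemma char_eq_cos_sin:
  assumes "real_distribution D"
  shows "char D t = complex_of_real (LINT x|D. cos (t * x)) + \<i> * complex_of_real (LINT x|D. sin (t * x))"
proof -
  interpret real_distribution D by fact
  have euler: "iexp y = complex_of_real (cos y) + \<i> * complex_of_real (sin y)" for y
    by (simp add: exp_Euler cos_of_real sin_of_real)
  have "char D t = (CLINT x|D. complex_of_real (cos (t*x)) + \<i> * complex_of_real (sin (t*x)))"
    unfolding char_def euler ..
  also have "\<dots> = (CLINT x|D. complex_of_real (cos (t*x))) + (CLINT x|D. \<i> * complex_of_real (sin (t*x)))"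
    by (intro Bochner_Integration.integral_add integrable_const_bound[of _ 1]) (auto simp: norm_mult)
  finally show ?thesis by simp
qed

text \<open>Levy's uniqueness theorem, applied to the laws of \<open>X\<close> and \<open>Y\<close> under the probability measures with
  densities proportional to \<open>V\<close> and \<open>W\<close>.
  Here \<open>t = 0\<close> shows that the two total masses agree.\<close>

lemma weighted_law_unique:
  fixes X V :: "'a \<Rightarrow> real" and Y W :: "'b \<Rightarrow> real"
  assumes M: "prob_space M" and N: "prob_space N"
    and [measurable]: "X \<in> borel_measurable M" "V \<in> borel_measurable M"
      "Y \<in> borel_measurable N" "W \<in> borel_measurable N" "B \<in> sets borel"
    and V: "\<And>\<omega>. 0 \<le> V \<omega>" "\<And>\<omega>. V \<omega> \<le> K" and W: "\<And>\<omega>. 0 \<le> W \<omega>" "\<And>\<omega>. W \<omega> \<le> K"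
    and cos: "\<And>t \<theta>. (LINT \<omega>|M. V \<omega> * cos (\<theta> + t * X \<omega>)) = (LINT \<omega>|N. W \<omega> * cos (\<theta> + t * Y \<omega>))"
  shows "(LINT \<omega>|M. V \<omega> * indicator B (X \<omega>)) = (LINT \<omega>|N. W \<omega> * indicator B (Y \<omega>))"
proof -
  interpret M: prob_space M by fact
  interpret N: prob_space N by fact
  have intV: "integrable M (\<lambda>\<omega>. V \<omega> * g \<omega>)" if [measurable]: "g \<in> borel_measurable M" and "\<And>\<omega>. \<bar>g \<omega>\<bar> \<le> 1" for g
  proof (rule M.integrable_const_bound[of _ K])
    have "V \<omega> * \<bar>g \<omega>\<bar> \<le> K * 1" for \<omega>
      using V that(2) order_trans[OF V] by (intro mult_mono) auto
    thus "AE \<omega> in M. norm (V \<omega> * g \<omega>) \<le> K" using V by (simp add: abs_mult)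
  qed simp
  have intW: "integrable N (\<lambda>\<omega>. W \<omega> * g \<omega>)" if [measurable]: "g \<in> borel_measurable N" and "\<And>\<omega>. \<bar>g \<omega>\<bar> \<le> 1" for g
  proof (rule N.integrable_const_bound[of _ K])
    have "W \<omega> * \<bar>g \<omega>\<bar> \<le> K * 1" for \<omega>
      using W that(2) order_trans[OF W] by (intro mult_mono) auto
    thus "AE \<omega> in N. norm (W \<omega> * g \<omega>) \<le> K" using W by (simp add: abs_mult)
  qed simp
  define m where "m = (LINT \<omega>|M. V \<omega>)"
  have m: "m = (LINT \<omega>|N. W \<omega>)" using cos[of 0 0] by (simp add: m_def)
  have iV: "integrable M V" using intV[of "\<lambda>_. 1"] by simp
  have iW: "integrable N W" using intW[of "\<lambda>_. 1"] by simp
  have m0: "m \<ge> 0" unfolding m_def by (intro Bochner_Integration.integral_nonneg V)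
  \<comment> \<open>Without mass there is nothing to normalise; both weights then vanish almost everywhere.\<close>
  show ?thesis
  proof (cases "m = 0")
    case True
    have "AE \<omega> in M. V \<omega> = 0"
      using integral_nonneg_eq_0_iff_AE[OF iV] V True by (simp add: m_def)
    hence "(LINT \<omega>|M. V \<omega> * indicator B (X \<omega>)) = (LINT \<omega>|M. 0)"
      by (intro integral_cong_AE) auto
    moreover have "AE \<omega> in N. W \<omega> = 0"
      using integral_nonneg_eq_0_iff_AE[OF iW] W True m by simp
    hence "(LINT \<omega>|N. W \<omega> * indicator B (Y \<omega>)) = (LINT \<omega>|N. 0)"
      by (intro integral_cong_AE) auto
    ultimately show ?thesis by simp
  next
    case False
    hence mpos: "m > 0" using m0 by simp
    define P where "P = distr (density M (\<lambda>\<omega>. V \<omega> / m)) borel X"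
    define Q where "Q = distr (density N (\<lambda>\<omega>. W \<omega> / m)) borel Y"
    have "prob_space (density M (\<lambda>\<omega>. V \<omega> / m))"
      using iV V mpos by (intro prob_spaceI) (simp add: emeasure_density nn_integral_eq_integral m_def[symmetric])
    hence P: "real_distribution P"
      unfolding P_def by (intro prob_space.real_distribution_distr) simp_all
    have "prob_space (density N (\<lambda>\<omega>. W \<omega> / m))"
      using iW W mpos by (intro prob_spaceI) (simp add: emeasure_density nn_integral_eq_integral m[symmetric])
    hence Q: "real_distribution Q"
      unfolding Q_def by (intro prob_space.real_distribution_distr) simp_all
    have intP: "(LINT x|P. g x) = (LINT \<omega>|M. V \<omega> * g (X \<omega>)) / m" 
      if [measurable]: "g \<in> borel_measurable borel" for g :: "real \<Rightarrow> real"
      using V mpos by (simp add: P_def integral_distr integral_density)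
    have intQ: "(LINT x|Q. g x) = (LINT \<omega>|N. W \<omega> * g (Y \<omega>)) / m" 
      if [measurable]: "g \<in> borel_measurable borel" for g :: "real \<Rightarrow> real"
      using W mpos by (simp add: Q_def integral_distr integral_density)
    have "char P = char Q"
    proof
      fix t
      have sin: "sin (t * x) = cos (pi/2 + (-t) * x)" for x by (simp add: sin_cos_eq)
      have "(LINT x|P. cos (t * x)) = (LINT x|Q. cos (t * x))"
        using cos[of 0 t] by (simp add: intP intQ)
      moreover have "(LINT x|P. sin (t * x)) = (LINT x|Q. sin (t * x))"
      proof -
        have "(LINT x|P. sin (t * x)) = (LINT \<omega>|M. V \<omega> * cos (pi/2 + (-t) * X \<omega>)) / m"
          unfolding sin by (rule intP) simp
        also have "\<dots> = (LINT x|Q. sin (t * x))"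
          unfolding sin cos by (rule intQ[symmetric]) simp
        finally show ?thesis .
      qed
      ultimately show "char P t = char Q t"
        by (simp add: char_eq_cos_sin[OF P] char_eq_cos_sin[OF Q])
    qed
    hence "P = Q" using Levy_uniqueness P Q by blast
    have "(LINT \<omega>|M. V \<omega> * indicator B (X \<omega>)) / m = (LINT x|P. indicator B x)"
      by (rule intP[symmetric]) simp
    also have "\<dots> = (LINT \<omega>|N. W \<omega> * indicator B (Y \<omega>)) / m"
      unfolding \<open>P = Q\<close> by (rule intQ) simp
    finally have "(LINT \<omega>|M. V \<omega> * indicator B (X \<omega>)) / m = (LINT \<omega>|N. W \<omega> * indicator B (Y \<omega>)) / m" .
    thus ?thesis using mpos by simp
  qed
qed

text \<open>The coordinates in \<open>J\<close> are moved one at a time from the cosine into an indicator.  To move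
  coordinate \<open>j\<close>, apply the one-dimensional theorem to \<open>X j\<close> with the nonnegative weight
  \<open>w (1 + cos (\<theta> + \<Sum> c i X i))\<close>, where \<open>w\<close> is the product of the earlier indicators: a product of cosines is
  a sum of cosines, so the induction hypothesis applies.  Applying it to the weight \<open>w\<close> as
  well removes the summand \<open>1\<close>, whose only purpose is to keep the weight nonnegative.\<close>

lemma cylinder_law_unique:
  fixes X :: "'i \<Rightarrow> 'a \<Rightarrow> real" and Y :: "'i \<Rightarrow> 'b \<Rightarrow> real"
  assumes M: "prob_space M" and N: "prob_space N"
    and X [measurable]: "\<And>i. X i \<in> borel_measurable M" and Y [measurable]: "\<And>i. Y i \<in> borel_measurable N"
    and cos: "\<And>c \<theta>. (LINT \<omega>|M. cos (\<theta> + (\<Sum>i\<in>I. c i * X i \<omega>))) = (LINT \<omega>|N. cos (\<theta> + (\<Sum>i\<in>I. c i * Y i \<omega>)))"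
    and I: "finite I" and B [measurable]: "\<And>i. i \<in> J \<Longrightarrow> B i \<in> sets borel" and J: "finite J" "J \<subseteq> I"
  shows "(LINT \<omega>|M. (\<Prod>i\<in>J. indicator (B i) (X i \<omega>)) * cos (\<theta> + (\<Sum>i\<in>I. c i * X i \<omega>)))
       = (LINT \<omega>|N. (\<Prod>i\<in>J. indicator (B i) (Y i \<omega>)) * cos (\<theta> + (\<Sum>i\<in>I. c i * Y i \<omega>)))"
  using J B
proof (induction J arbitrary: \<theta> c rule: finite_induct)
  case empty
  thus ?case using cos by simp
next
  case (insert j J)
  interpret M: prob_space M by fact
  interpret N: prob_space N by fact
  have [measurable]: "\<And>i. i \<in> J \<Longrightarrow> B i \<in> sets borel" "B j \<in> sets borel" using insert.prems by auto
  let ?WX = "\<lambda>\<omega>. \<Prod>i\<in>J. indicator (B i) (X i \<omega>) :: real"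
  let ?WY = "\<lambda>\<omega>. \<Prod>i\<in>J. indicator (B i) (Y i \<omega>) :: real"
  let ?SX = "\<lambda>c \<omega>. \<Sum>i\<in>I. c i * X i \<omega>" and ?SY = "\<lambda>c \<omega>. \<Sum>i\<in>I. c i * Y i \<omega>"
  have IH: "(LINT \<omega>|M. ?WX \<omega> * cos (\<theta> + ?SX c \<omega>)) = (LINT \<omega>|N. ?WY \<omega> * cos (\<theta> + ?SY c \<omega>))" for \<theta> c
    using insert.IH insert.prems by simp
  have W01: "0 \<le> ?WX \<omega>" "?WX \<omega> \<le> 1" "0 \<le> ?WY \<omega>'" "?WY \<omega>' \<le> 1" for \<omega> \<omega>'
    by (auto intro!: prod_nonneg prod_le_1)
  have iX: "integrable M (\<lambda>\<omega>. ?WX \<omega> * g \<omega>)" if [measurable]: "g \<in> borel_measurable M" and "\<And>\<omega>. \<bar>g \<omega>\<bar> \<le> 1" for g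
    using W01 that(2) by (intro M.integrable_const_bound[of _ 1]) (auto intro!: AE_I2 simp: abs_mult intro: mult_le_one)
  have iY: "integrable N (\<lambda>\<omega>. ?WY \<omega> * g \<omega>)" if [measurable]: "g \<in> borel_measurable N" and "\<And>\<omega>. \<bar>g \<omega>\<bar> \<le> 1" for g
    using W01 that(2) by (intro N.integrable_const_bound[of _ 1]) (auto intro!: AE_I2 simp: abs_mult intro: mult_le_one)
  have cos1: "0 \<le> 1 + cos y" "1 + cos y \<le> 2" for y :: real
    using cos_ge_minus_one[of y] cos_le_one[of y] by linarith+
  have j: "j \<in> I" using insert.prems by simp
  \<comment> \<open>The product-to-sum formula; the angles are grouped so that the coefficients stay linear.\<close>
  have trig: "w * (1 + cos (\<theta> + a)) * cos (\<phi> + b)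
      = w * cos (\<phi> + b) + 1/2 * (w * cos ((\<theta> + \<phi>) + (a + b))) + 1/2 * (w * cos ((\<theta> - \<phi>) + (a - b)))"
    for w a b \<theta> \<phi> :: real
  proof -
    have "cos ((\<theta> + \<phi>) + (a + b)) + cos ((\<theta> - \<phi>) + (a - b)) = 2 * (cos (\<theta> + a) * cos (\<phi> + b))"
      using cos_times_cos[of "\<theta> + a" "\<phi> + b"] by (simp add: algebra_simps)
    hence "w * cos ((\<theta> + \<phi>) + (a + b)) + w * cos ((\<theta> - \<phi>) + (a - b)) = w * (2 * (cos (\<theta> + a) * cos (\<phi> + b)))"
      by (simp flip: distrib_left)
    thus ?thesis by (simp add: distrib_left distrib_right)
  qed
  have SX: "?SX (c(j := c j + t)) \<omega> = ?SX c \<omega> + t * X j \<omega>" for c t \<omega>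
    using I j by (subst (1 2) sum.remove[of I j]) (simp_all add: algebra_simps)
  have SY: "?SY (c(j := c j + t)) \<omega> = ?SY c \<omega> + t * Y j \<omega>" for c t \<omega>
    using I j by (subst (1 2) sum.remove[of I j]) (simp_all add: algebra_simps)
  have IH': "(LINT \<omega>|M. ?WX \<omega> * cos (\<theta> + (?SX c \<omega> + t * X j \<omega>))) = (LINT \<omega>|N. ?WY \<omega> * cos (\<theta> + (?SY c \<omega> + t * Y j \<omega>)))" for \<theta> c t
    using IH[of \<theta> "c(j := c j + t)"] unfolding SX SY .
  have IH0: "(LINT \<omega>|M. ?WX \<omega> * cos (\<theta> + t * X j \<omega>)) = (LINT \<omega>|N. ?WY \<omega> * cos (\<theta> + t * Y j \<omega>))" for \<theta> t
    using IH'[of \<theta> "\<lambda>_. 0" t] by simp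
  have IH'': "(LINT \<omega>|M. ?WX \<omega> * cos (\<theta> + (?SX c \<omega> - t * X j \<omega>))) = (LINT \<omega>|N. ?WY \<omega> * cos (\<theta> + (?SY c \<omega> - t * Y j \<omega>)))" for \<theta> c t
    using IH'[of \<theta> c "-t"] by simp
  have 1: "(LINT \<omega>|M. ?WX \<omega> * (1 + cos (\<theta> + ?SX c \<omega>)) * indicator (B j) (X j \<omega>))
      = (LINT \<omega>|N. ?WY \<omega> * (1 + cos (\<theta> + ?SY c \<omega>)) * indicator (B j) (Y j \<omega>))"
  proof (rule weighted_law_unique[OF M N, where K=2])
    fix t \<phi>
    show "(LINT \<omega>|M. ?WX \<omega> * (1 + cos (\<theta> + ?SX c \<omega>)) * cos (\<phi> + t * X j \<omega>))
      = (LINT \<omega>|N. ?WY \<omega> * (1 + cos (\<theta> + ?SY c \<omega>)) * cos (\<phi> + t * Y j \<omega>))"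
    proof -
      have "(LINT \<omega>|M. ?WX \<omega> * (1 + cos (\<theta> + ?SX c \<omega>)) * cos (\<phi> + t * X j \<omega>))
        = (LINT \<omega>|M. ?WX \<omega> * cos (\<phi> + t * X j \<omega>))
          + 1/2 * (LINT \<omega>|M. ?WX \<omega> * cos ((\<theta> + \<phi>) + (?SX c \<omega> + t * X j \<omega>)))
          + 1/2 * (LINT \<omega>|M. ?WX \<omega> * cos ((\<theta> - \<phi>) + (?SX c \<omega> - t * X j \<omega>)))"
        unfolding trig
        by (simp add: iX Bochner_Integration.integral_add Bochner_Integration.integrable_add)
      moreover have "(LINT \<omega>|N. ?WY \<omega> * (1 + cos (\<theta> + ?SY c \<omega>)) * cos (\<phi> + t * Y j \<omega>))
        = (LINT \<omega>|N. ?WY \<omega> * cos (\<phi> + t * Y j \<omega>))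
          + 1/2 * (LINT \<omega>|N. ?WY \<omega> * cos ((\<theta> + \<phi>) + (?SY c \<omega> + t * Y j \<omega>)))
          + 1/2 * (LINT \<omega>|N. ?WY \<omega> * cos ((\<theta> - \<phi>) + (?SY c \<omega> - t * Y j \<omega>)))"
        unfolding trig
        by (simp add: iY Bochner_Integration.integral_add Bochner_Integration.integrable_add)
      ultimately show ?thesis unfolding IH0 IH' IH'' by simp
    qed
  next
    fix \<omega>
    show "0 \<le> ?WX \<omega> * (1 + cos (\<theta> + ?SX c \<omega>))" "?WX \<omega> * (1 + cos (\<theta> + ?SX c \<omega>)) \<le> 2"
      using W01(1,2)[of \<omega>] cos1[of "\<theta> + ?SX c \<omega>"]
        mult_mono[of "?WX \<omega>" 1 "1 + cos (\<theta> + ?SX c \<omega>)" 2] by (auto intro: mult_nonneg_nonneg simp del: prod_nonneg)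
  next
    fix \<omega>
    show "0 \<le> ?WY \<omega> * (1 + cos (\<theta> + ?SY c \<omega>))" "?WY \<omega> * (1 + cos (\<theta> + ?SY c \<omega>)) \<le> 2"
      using W01(3,4)[of \<omega>] cos1[of "\<theta> + ?SY c \<omega>"]
        mult_mono[of "?WY \<omega>" 1 "1 + cos (\<theta> + ?SY c \<omega>)" 2] by (auto intro: mult_nonneg_nonneg simp del: prod_nonneg)
  qed simp_all
  have 2: "(LINT \<omega>|M. ?WX \<omega> * indicator (B j) (X j \<omega>)) = (LINT \<omega>|N. ?WY \<omega> * indicator (B j) (Y j \<omega>))"
  proof (rule weighted_law_unique[OF M N, where K=1])
    fix t \<phi>
    show "(LINT \<omega>|M. ?WX \<omega> * cos (\<phi> + t * X j \<omega>)) = (LINT \<omega>|N. ?WY \<omega> * cos (\<phi> + t * Y j \<omega>))"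
      by (rule IH0)
  qed (simp_all add: W01)
  have eqX: "(LINT \<omega>|M. ?WX \<omega> * (1 + cos (\<theta> + ?SX c \<omega>)) * indicator (B j) (X j \<omega>))
     = (LINT \<omega>|M. ?WX \<omega> * indicator (B j) (X j \<omega>)) + (LINT \<omega>|M. ?WX \<omega> * (cos (\<theta> + ?SX c \<omega>) * indicator (B j) (X j \<omega>)))"
    unfolding distrib_left distrib_right mult_1_right mult.assoc
    by (intro Bochner_Integration.integral_add iX) (auto simp: abs_mult intro: mult_le_one)
  have eqY: "(LINT \<omega>|N. ?WY \<omega> * (1 + cos (\<theta> + ?SY c \<omega>)) * indicator (B j) (Y j \<omega>))
     = (LINT \<omega>|N. ?WY \<omega> * indicator (B j) (Y j \<omega>)) + (LINT \<omega>|N. ?WY \<omega> * (cos (\<theta> + ?SY c \<omega>) * indicator (B j) (Y j \<omega>)))"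
    unfolding distrib_left distrib_right mult_1_right mult.assoc
    by (intro Bochner_Integration.integral_add iY) (auto simp: abs_mult intro: mult_le_one)
  show ?case
    using 1 2 unfolding eqX eqY using insert.hyps by (simp add: mult_ac)
qed

text \<open>Cylinder sets generate the product sigma-algebra, and their probabilities are the case of zero
  coefficients in \<open>cylinder_law_unique\<close>.\<close>

lemma field_law_unique:
  fixes X :: "'i \<Rightarrow> 'a \<Rightarrow> real" and Y :: "'i \<Rightarrow> 'b \<Rightarrow> real"
  assumes M: "prob_space M" and N: "prob_space N"
    and X [measurable]: "\<And>i. X i \<in> borel_measurable M" and Y [measurable]: "\<And>i. Y i \<in> borel_measurable N"
    and cos: "\<And>I c \<theta>. finite I \<Longrightarrow>
      (LINT \<omega>|M. cos (\<theta> + (\<Sum>i\<in>I. c i * X i \<omega>))) = (LINT \<omega>|N. cos (\<theta> + (\<Sum>i\<in>I. c i * Y i \<omega>)))"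
  shows "distr M (\<Pi>\<^sub>M i\<in>UNIV. borel) (\<lambda>\<omega> i. X i \<omega>) = distr N (\<Pi>\<^sub>M i\<in>UNIV. borel) (\<lambda>\<omega> i. Y i \<omega>)"
proof -
  interpret M: prob_space M by fact
  interpret N: prob_space N by fact
  have mX [measurable]: "(\<lambda>\<omega> i. X i \<omega>) \<in> measurable M (\<Pi>\<^sub>M i\<in>UNIV. borel)"
    by (rule measurable_PiM_single') auto
  have mY [measurable]: "(\<lambda>\<omega> i. Y i \<omega>) \<in> measurable N (\<Pi>\<^sub>M i\<in>UNIV. borel)"
    by (rule measurable_PiM_single') auto
  show ?thesis
  proof (rule measure_eqI_PiM_infinite)
    fix A :: "'i \<Rightarrow> real set" and J :: "'i set"
    assume J: "finite J" "J \<subseteq> UNIV" and A [measurable]: "\<And>i. i \<in> J \<Longrightarrow> A i \<in> sets borel"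
    let ?C = "prod_emb UNIV (\<lambda>_. borel) J (Pi\<^sub>E J A)"
    have C [measurable]: "?C \<in> sets (\<Pi>\<^sub>M i\<in>UNIV. borel)"
      using J A by (intro sets_PiM_I) auto
    have "emeasure (distr M (\<Pi>\<^sub>M i\<in>UNIV. borel) (\<lambda>\<omega> i. X i \<omega>)) ?C = M.prob {\<omega>\<in>space M. \<forall>i\<in>J. X i \<omega> \<in> A i}"
      unfolding emeasure_distr[OF mX C] M.emeasure_eq_measure
      by (intro arg_cong[where f=ennreal] arg_cong[where f=M.prob]) (auto simp: prod_emb_def restrict_PiE_iff)
    also have "M.prob {\<omega>\<in>space M. \<forall>i\<in>J. X i \<omega> \<in> A i} = (LINT \<omega>|M. indicator {\<omega>\<in>space M. \<forall>i\<in>J. X i \<omega> \<in> A i} \<omega>)"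
      using J by simp
    also have "\<dots> = (LINT \<omega>|M. (\<Prod>i\<in>J. indicator (A i) (X i \<omega>)) * cos (0 + (\<Sum>i\<in>J. 0 * X i \<omega>)))"
      using J(1) by (intro Bochner_Integration.integral_cong refl) (auto simp: indicator_def)
    also have "\<dots> = (LINT \<omega>|N. (\<Prod>i\<in>J. indicator (A i) (Y i \<omega>)) * cos (0 + (\<Sum>i\<in>J. 0 * Y i \<omega>)))"
      by (rule cylinder_law_unique[OF M N X Y cos[OF J(1)] J(1) A J(1)]) auto
    also have "\<dots> = (LINT \<omega>|N. indicator {\<omega>\<in>space N. \<forall>i\<in>J. Y i \<omega> \<in> A i} \<omega>)"
      using J(1) by (intro Bochner_Integration.integral_cong refl) (auto simp: indicator_def)
    also have "\<dots> = N.prob {\<omega>\<in>space N. \<forall>i\<in>J. Y i \<omega> \<in> A i}"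
      using J by simp
    also have "\<dots> = emeasure (distr N (\<Pi>\<^sub>M i\<in>UNIV. borel) (\<lambda>\<omega> i. Y i \<omega>)) ?C"
      unfolding emeasure_distr[OF mY C] N.emeasure_eq_measure
      by (intro arg_cong[where f=ennreal] arg_cong[where f=N.prob]) (auto simp: prod_emb_def restrict_PiE_iff)
    finally show "emeasure (distr M (\<Pi>\<^sub>M i\<in>UNIV. borel) (\<lambda>\<omega> i. X i \<omega>)) ?C
      = emeasure (distr N (\<Pi>\<^sub>M i\<in>UNIV. borel) (\<lambda>\<omega> i. Y i \<omega>)) ?C" .
  next
    show "finite_measure (distr M (\<Pi>\<^sub>M i\<in>UNIV. borel) (\<lambda>\<omega> i. X i \<omega>))"
      by (rule M.finite_measure_distr) measurable
  qed simp_all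
qed

section \<open>Centred Gaussian random variables\<close>

lemma std_normal_cos_sin:
  "(LINT x|std_normal_distribution. cos (t * x)) = exp (- t\<^sup>2 / 2)"
  "(LINT x|std_normal_distribution. sin (t * x)) = 0"
proof -
  have "complex_of_real (LINT x|std_normal_distribution. cos (t * x))
      + \<i> * complex_of_real (LINT x|std_normal_distribution. sin (t * x)) = complex_of_real (exp (- (t^2) / 2))"
    using char_eq_cos_sin[OF real_dist_normal_dist, of t] char_std_normal_distribution by simp
  thus "(LINT x|std_normal_distribution. cos (t * x)) = exp (- t\<^sup>2 / 2)"
    "(LINT x|std_normal_distribution. sin (t * x)) = 0"
    by (simp_all add: complex_eq_iff)
qed

lemma (in prob_space) centred_gaussian_cases:
  assumes "gaussian_rv M X" and "expectation X = 0"
  obtains "AE \<omega> in M. X \<omega> = 0" | \<sigma> where "\<sigma> > 0" "distributed M lborel X (normal_density 0 \<sigma>)"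
proof -
  obtain \<mu> \<sigma> where X [measurable]: "X \<in> borel_measurable M" and
    *: "(\<sigma> = 0 \<and> (AE \<omega> in M. X \<omega> = \<mu>)) \<or> (\<sigma> > 0 \<and> distributed M lborel X (normal_density \<mu> \<sigma>))"
    using assms(1) unfolding gaussian_rv_def by blast
  from * show ?thesis
  proof
    assume A: "\<sigma> = 0 \<and> (AE \<omega> in M. X \<omega> = \<mu>)"
    hence "expectation X = expectation (\<lambda>_. \<mu>)" by (intro integral_cong_AE) auto
    hence "\<mu> = 0" using assms(2) by (simp add: prob_space)
    thus ?thesis using A that(1) by auto
  next
    assume A: "\<sigma> > 0 \<and> distributed M lborel X (normal_density \<mu> \<sigma>)"
    hence "expectation X = \<mu>" by (intro normal_distributed_expectation) auto
    thus ?thesis using A that(2) assms(2) by auto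
  qed
qed

lemma (in prob_space) integrable_gaussian_rv:
  assumes "gaussian_rv M X"
  shows "integrable M X"
proof -
  obtain \<mu> \<sigma> where X [measurable]: "X \<in> borel_measurable M" and
    *: "(\<sigma> = 0 \<and> (AE \<omega> in M. X \<omega> = \<mu>)) \<or> (\<sigma> > 0 \<and> distributed M lborel X (normal_density \<mu> \<sigma>))"
    using assms unfolding gaussian_rv_def by blast
  from * show ?thesis
  proof
    assume A: "\<sigma> = 0 \<and> (AE \<omega> in M. X \<omega> = \<mu>)"
    show ?thesis by (rule integrable_const_bound[of _ "\<bar>\<mu>\<bar>"]) (use A in auto)
  next
    assume A: "\<sigma> > 0 \<and> distributed M lborel X (normal_density \<mu> \<sigma>)"
    have "integrable lborel (\<lambda>x. normal_density \<mu> \<sigma> x * (x - \<mu>) ^ 1 + normal_density \<mu> \<sigma> x * \<mu>)"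
      using A by (intro Bochner_Integration.integrable_add integrable_normal_moment integrable_mult_left integrable_normal_density) auto
    hence "integrable lborel (\<lambda>x. normal_density \<mu> \<sigma> x * x)" by (simp add: algebra_simps)
    thus ?thesis using A
      by (subst (asm) distributed_integrable[where g="\<lambda>x. x"]) (auto simp: normal_density_nonneg)
  qed
qed

text \<open>The last bound is the length \<open>2 d\<close> of the interval times the maximum of the density, which
  is \<open>1 / (sqrt (2 pi) \<sigma>) \<le> 1 / (2 \<sigma>)\<close>.\<close>

lemma (in prob_space) centred_gaussian_moments:
  assumes X: "gaussian_rv M X" "expectation X = 0"
  shows "integrable M (\<lambda>\<omega>. (X \<omega>)\<^sup>2)"
    and "expectation (\<lambda>\<omega>. cos (\<theta> + X \<omega>)) = cos \<theta> * exp (- expectation (\<lambda>\<omega>. (X \<omega>)\<^sup>2) / 2)"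
    and "expectation (\<lambda>\<omega>. (X \<omega>)\<^sup>2) > 0 \<Longrightarrow> d \<ge> 0 \<Longrightarrow>
      prob {\<omega>\<in>space M. \<bar>X \<omega> - a\<bar> \<le> d} \<le> d / sqrt (expectation (\<lambda>\<omega>. (X \<omega>)\<^sup>2))"
proof -
  have [measurable]: "X \<in> borel_measurable M" using X(1) by (simp add: gaussian_rv_def)
  have "integrable M (\<lambda>\<omega>. (X \<omega>)\<^sup>2) \<and>
    expectation (\<lambda>\<omega>. cos (\<theta> + X \<omega>)) = cos \<theta> * exp (- expectation (\<lambda>\<omega>. (X \<omega>)\<^sup>2) / 2) \<and>
    (expectation (\<lambda>\<omega>. (X \<omega>)\<^sup>2) > 0 \<longrightarrow> d \<ge> 0 \<longrightarrow>
      prob {\<omega>\<in>space M. \<bar>X \<omega> - a\<bar> \<le> d} \<le> d / sqrt (expectation (\<lambda>\<omega>. (X \<omega>)\<^sup>2)))"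
    using X
  proof (cases rule: centred_gaussian_cases)
    case 1
    have "integrable M (\<lambda>\<omega>. (X \<omega>)\<^sup>2)"
      by (rule integrable_const_bound[of _ 0]) (use 1 in auto)
    moreover have v: "expectation (\<lambda>\<omega>. (X \<omega>)\<^sup>2) = 0"
      by (subst integral_cong_AE[where g="\<lambda>_. 0"]) (use 1 in auto)
    moreover have "expectation (\<lambda>\<omega>. cos (\<theta> + X \<omega>)) = expectation (\<lambda>_. cos \<theta>)"
      by (rule integral_cong_AE) (use 1 in auto)
    ultimately show ?thesis by (simp add: prob_space)
  next
    case (2 \<sigma>)
    note \<sigma> = 2(1) and D = 2(2)
    have int: "integrable M (\<lambda>\<omega>. (X \<omega>)\<^sup>2)"
      using integrable_normal_moment[of \<sigma> 0 2] \<sigma> D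
      by (subst distributed_integrable[where g="\<lambda>x. x\<^sup>2", symmetric]) (auto simp: normal_density_nonneg)
    have v: "expectation (\<lambda>\<omega>. (X \<omega>)\<^sup>2) = \<sigma>\<^sup>2"
      using normal_distributed_variance[OF \<sigma> D] X(2) by simp
    have D1: "distributed M lborel (\<lambda>\<omega>. X \<omega> / \<sigma>) std_normal_density"
      using normal_standard_normal_convert[OF \<sigma>, of X 0] D by simp
    have E: "expectation (\<lambda>\<omega>. cos (\<theta> + X \<omega>)) = (LINT x|std_normal_distribution. cos (\<theta> + \<sigma> * x))"
    proof -
      have "(LINT x|std_normal_distribution. cos (\<theta> + \<sigma> * x)) = (LINT x|lborel. std_normal_density x * cos (\<theta> + \<sigma> * x))"
        by (subst integral_density) (auto simp: normal_density_nonneg)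
      also have "\<dots> = expectation (\<lambda>\<omega>. cos (\<theta> + \<sigma> * (X \<omega> / \<sigma>)))"
        by (rule distributed_integral[OF D1]) (auto simp: normal_density_nonneg)
      finally show ?thesis using \<sigma> by simp
    qed
    interpret S: real_distribution std_normal_distribution by (rule real_dist_normal_dist)
    have "(LINT x|std_normal_distribution. cos (\<theta> + \<sigma> * x))
        = (LINT x|std_normal_distribution. cos \<theta> * cos (\<sigma> * x) - sin \<theta> * sin (\<sigma> * x))"
      by (simp add: cos_add)
    also have "\<dots> = (LINT x|std_normal_distribution. cos \<theta> * cos (\<sigma> * x)) - (LINT x|std_normal_distribution. sin \<theta> * sin (\<sigma> * x))"
      by (intro Bochner_Integration.integral_diff integrable_mult_right S.integrable_const_bound[of _ 1]) auto
    finally have "expectation (\<lambda>\<omega>. cos (\<theta> + X \<omega>)) = cos \<theta> * exp (- \<sigma>\<^sup>2 / 2)"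
      using E by (simp add: std_normal_cos_sin)
    moreover have "prob {\<omega>\<in>space M. \<bar>X \<omega> - a\<bar> \<le> d} \<le> d / \<sigma>" if "d \<ge> 0"
    proof -
      have "2 \<le> sqrt (2 * pi)" using pi_gt3 by (intro real_le_rsqrt) simp
      have le: "normal_density 0 \<sigma> x \<le> 1 / (2 * \<sigma>)" for x
      proof -
        have "normal_density 0 \<sigma> x \<le> 1 / sqrt (2 * pi * \<sigma>\<^sup>2) * 1"
          unfolding normal_density_def by (intro mult_left_mono) auto
        also have "\<dots> = 1 / (sqrt (2 * pi) * \<sigma>)" using \<sigma> by (simp add: real_sqrt_mult)
        also have "\<dots> \<le> 1 / (2 * \<sigma>)" using \<sigma> \<open>2 \<le> sqrt (2 * pi)\<close> by (intro divide_left_mono mult_right_mono mult_pos_pos) auto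
        finally show ?thesis .
      qed
      have set: "{\<omega>\<in>space M. \<bar>X \<omega> - a\<bar> \<le> d} = X -` {a-d..a+d} \<inter> space M" by auto
      have "emeasure M {\<omega>\<in>space M. \<bar>X \<omega> - a\<bar> \<le> d} = (\<integral>\<^sup>+x. ennreal (normal_density 0 \<sigma> x) * indicator {a-d..a+d} x \<partial>lborel)"
        unfolding set by (rule distributed_emeasure[OF D]) simp
      also have "\<dots> \<le> (\<integral>\<^sup>+x. ennreal (1 / (2 * \<sigma>)) * indicator {a-d..a+d} x \<partial>lborel)"
        by (intro nn_integral_mono mult_right_mono ennreal_leI le) simp
      also have "\<dots> = ennreal (1 / (2 * \<sigma>)) * ennreal (2 * d)"
        using that by (simp add: nn_integral_cmult_indicator)
      also have "\<dots> = ennreal (d / \<sigma>)"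
        using that \<sigma> by (simp flip: ennreal_mult)
      finally show ?thesis using that \<sigma> by (simp add: emeasure_eq_measure)
    qed
    ultimately show ?thesis using int v \<sigma> by simp
  qed
  thus "integrable M (\<lambda>\<omega>. (X \<omega>)\<^sup>2)"
    "expectation (\<lambda>\<omega>. cos (\<theta> + X \<omega>)) = cos \<theta> * exp (- expectation (\<lambda>\<omega>. (X \<omega>)\<^sup>2) / 2)"
    "expectation (\<lambda>\<omega>. (X \<omega>)\<^sup>2) > 0 \<Longrightarrow> d \<ge> 0 \<Longrightarrow>
      prob {\<omega>\<in>space M. \<bar>X \<omega> - a\<bar> \<le> d} \<le> d / sqrt (expectation (\<lambda>\<omega>. (X \<omega>)\<^sup>2))"
    by blast+
qed

section \<open>Gaussian fields with the Cauchy covariance\<close>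

lemma swap_diff: "swap x - swap y = swap (x - y)"
  by (simp add: vec_eq_iff forall_2)

lemma norm_swap [simp]: "norm (swap x) = norm x"
  by (simp add: norm_vec_def L2_set_def sum_2 add.commute)

lemma cauchy_kernel_swap [simp]: "cauchy_kernel \<alpha> (swap x) = cauchy_kernel \<alpha> x"
  by (simp add: cauchy_kernel_def)

lemma continuous_on_cauchy_kernel [continuous_intros]:
  "continuous_on S g \<Longrightarrow> continuous_on S (\<lambda>x. cauchy_kernel \<alpha> (g x))"
  unfolding cauchy_kernel_def by (intro continuous_intros) (auto simp: add_nonneg_eq_0_iff)

text \<open>The covariance determines the law of a centred Gaussian field, so the symmetries of the field are
  read off from the kernel.\<close>

locale cauchy_field = prob_space M for M :: "'w measure" +
  fixes f :: "real^2 \<Rightarrow> 'w \<Rightarrow> real" and \<alpha> :: real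
  assumes gaussian: "gaussian_field M f" and centred: "centred_field M f"
    and covariance: "\<And>x y. expectation (\<lambda>\<omega>. f x \<omega> * f y \<omega>) = cauchy_kernel \<alpha> (y - x)"
    and continuous: "AE \<omega> in M. continuous_on UNIV (\<lambda>x. f x \<omega>)"
begin

definition combinations :: "('w \<Rightarrow> real) set" where
  "combinations = {\<lambda>\<omega>. \<Sum>x\<in>S. c x * f x \<omega> |S c. finite S}"

lemma combinationsI: "finite S \<Longrightarrow> (\<lambda>\<omega>. \<Sum>x\<in>S. c x * f x \<omega>) \<in> combinations"
  unfolding combinations_def by blast

lemma field_in_combinations: "f x \<in> combinations"
  using combinationsI[of "{x}" "\<lambda>_. 1"] by simp

lemma combinations_scale: "Y \<in> combinations \<Longrightarrow> (\<lambda>\<omega>. t * Y \<omega>) \<in> combinations"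
  unfolding combinations_def
proof clarify
  fix S :: "(real^2) set" and c :: "real^2 \<Rightarrow> real" assume "finite S"
  thus "\<exists>S' c'. (\<lambda>\<omega>. t * (\<Sum>x\<in>S. c x * f x \<omega>)) = (\<lambda>\<omega>. \<Sum>x\<in>S'. c' x * f x \<omega>) \<and> finite S'"
    by (intro exI[of _ S] exI[of _ "\<lambda>x. t * c x"]) (simp add: sum_distrib_left mult_ac)
qed

lemma combinations_add:
  assumes "Y \<in> combinations" "Y' \<in> combinations"
  shows "(\<lambda>\<omega>. Y \<omega> + Y' \<omega>) \<in> combinations"
proof -
  obtain S c S' c' where S: "finite S" "Y = (\<lambda>\<omega>. \<Sum>x\<in>S. c x * f x \<omega>)"
    "finite S'" "Y' = (\<lambda>\<omega>. \<Sum>x\<in>S'. c' x * f x \<omega>)"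
    using assms unfolding combinations_def by blast
  define e where "e x = (if x \<in> S then c x else 0) + (if x \<in> S' then c' x else 0)" for x
  have "Y \<omega> + Y' \<omega> = (\<Sum>x\<in>S\<union>S'. e x * f x \<omega>)" for \<omega>
  proof -
    have "Y \<omega> = (\<Sum>x\<in>S\<union>S'. (if x \<in> S then c x else 0) * f x \<omega>)"
      unfolding S using S by (intro sum.mono_neutral_cong_left) auto
    moreover have "Y' \<omega> = (\<Sum>x\<in>S\<union>S'. (if x \<in> S' then c' x else 0) * f x \<omega>)"
      unfolding S using S by (intro sum.mono_neutral_cong_left) auto
    ultimately show ?thesis by (simp add: e_def distrib_right sum.distrib)
  qed
  hence "(\<lambda>\<omega>. Y \<omega> + Y' \<omega>) = (\<lambda>\<omega>. \<Sum>x\<in>S\<union>S'. e x * f x \<omega>)" by blast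
  thus ?thesis using combinationsI[of "S \<union> S'" e] S by simp
qed

lemma gaussian_combination: "Y \<in> combinations \<Longrightarrow> gaussian_rv M Y"
  using gaussian unfolding combinations_def gaussian_field_def by blast

lemma measurable_combination: "Y \<in> combinations \<Longrightarrow> Y \<in> borel_measurable M"
  using gaussian_combination by (simp add: gaussian_rv_def)

lemma measurable_field [measurable]: "f x \<in> borel_measurable M"
  by (rule measurable_combination[OF field_in_combinations])

lemma expectation_combination: "Y \<in> combinations \<Longrightarrow> expectation Y = 0"
  unfolding combinations_def
proof clarify
  fix S :: "(real^2) set" and c :: "real^2 \<Rightarrow> real" assume "finite S"
  have "integrable M (f x)" for x
    by (rule integrable_gaussian_rv[OF gaussian_combination[OF field_in_combinations]])
  thus "expectation (\<lambda>\<omega>. \<Sum>x\<in>S. c x * f x \<omega>) = 0"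
    using centred by (simp add: centred_field_def)
qed

lemma integrable_combination_mult:
  assumes "Y \<in> combinations" "Y' \<in> combinations"
  shows "integrable M (\<lambda>\<omega>. Y \<omega> * Y' \<omega>)"
proof (rule Bochner_Integration.integrable_bound)
  show "integrable M (\<lambda>\<omega>. (Y \<omega>)\<^sup>2 + (Y' \<omega>)\<^sup>2)"
    using assms by (intro Bochner_Integration.integrable_add centred_gaussian_moments(1) gaussian_combination expectation_combination)
  have "\<bar>a * b\<bar> \<le> a\<^sup>2 + b\<^sup>2" for a b :: real
  proof -
    have "2 * \<bar>a * b\<bar> \<le> a\<^sup>2 + b\<^sup>2"
      using sum_squares_bound[of "\<bar>a\<bar>" "\<bar>b\<bar>"] by (simp add: abs_mult mult.assoc)
    thus ?thesis using abs_ge_zero[of "a * b"] by linarith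
  qed
  thus "AE \<omega> in M. norm (Y \<omega> * Y' \<omega>) \<le> norm ((Y \<omega>)\<^sup>2 + (Y' \<omega>)\<^sup>2)"
    by (auto intro!: AE_I2)
qed (intro borel_measurable_times measurable_combination assms)

lemma expectation_cos_combination:
  "Y \<in> combinations \<Longrightarrow> expectation (\<lambda>\<omega>. cos (\<theta> + Y \<omega>)) = cos \<theta> * exp (- expectation (\<lambda>\<omega>. (Y \<omega>)\<^sup>2) / 2)"
  by (intro centred_gaussian_moments(2) gaussian_combination expectation_combination)

lemma covariance_combination:
  assumes "finite S" "finite S'"
  shows "expectation (\<lambda>\<omega>. (\<Sum>x\<in>S. c x * f x \<omega>) * (\<Sum>y\<in>S'. d y * f y \<omega>))
    = (\<Sum>x\<in>S. \<Sum>y\<in>S'. c x * d y * cauchy_kernel \<alpha> (y - x))"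
proof -
  have i: "integrable M (\<lambda>\<omega>. c x * d y * (f x \<omega> * f y \<omega>))" for x y
    by (intro integrable_mult_right integrable_combination_mult field_in_combinations)
  have "expectation (\<lambda>\<omega>. (\<Sum>x\<in>S. c x * f x \<omega>) * (\<Sum>y\<in>S'. d y * f y \<omega>))
    = expectation (\<lambda>\<omega>. \<Sum>x\<in>S. \<Sum>y\<in>S'. c x * d y * (f x \<omega> * f y \<omega>))"
    by (simp add: sum_product mult_ac)
  also have "\<dots> = (\<Sum>x\<in>S. \<Sum>y\<in>S'. expectation (\<lambda>\<omega>. c x * d y * (f x \<omega> * f y \<omega>)))"
    using i by (simp add: Bochner_Integration.integral_sum Bochner_Integration.integrable_sum del: Bochner_Integration.integral_mult_right_zero)
  finally show ?thesis by (simp add: covariance)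
qed

lemma field_law_eqI:
  fixes Y :: "real^2 \<Rightarrow> 'n \<Rightarrow> real"
  assumes N: "prob_space N" and Y: "\<And>x. Y x \<in> borel_measurable N"
    and cos: "\<And>S c \<theta>. finite S \<Longrightarrow> (LINT \<omega>|N. cos (\<theta> + (\<Sum>x\<in>S. c x * Y x \<omega>)))
      = cos \<theta> * exp (- expectation (\<lambda>\<omega>. (\<Sum>x\<in>S. c x * f x \<omega>)\<^sup>2) / 2)"
  shows "field_law N Y = field_law M f"
  unfolding field_law_def
  by (intro field_law_unique N Y measurable_field prob_space_axioms)
     (simp add: cos expectation_cos_combination combinationsI)

text \<open>The kernel is invariant under the reflection, and the sign cancels in covariances.\<close>

lemma field_law_negate_swap: "field_law M (\<lambda>x \<omega>. - f (swap x) \<omega>) = field_law M f"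
proof (rule field_law_eqI)
  fix S :: "(real^2) set" and c :: "real^2 \<Rightarrow> real" and \<theta> :: real
  assume S: "finite S"
  let ?Y = "\<lambda>\<omega>. \<Sum>x\<in>S. c x * - f (swap x) \<omega>"
  let ?d = "\<lambda>x. - c (swap x)"
  have inj: "inj_on swap S" by (metis inj_on_inverseI swap_swap)
  have Y: "?Y = (\<lambda>\<omega>. \<Sum>x\<in>swap ` S. ?d x * f x \<omega>)"
    using inj by (simp add: sum.reindex)
  have Y': "?Y \<omega> = (\<Sum>x\<in>swap ` S. ?d x * f x \<omega>)" for \<omega>
    by (rule fun_cong[OF Y])
  have "expectation (\<lambda>\<omega>. (?Y \<omega>)\<^sup>2) = (\<Sum>x\<in>swap ` S. \<Sum>y\<in>swap ` S. ?d x * ?d y * cauchy_kernel \<alpha> (y - x))"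
    unfolding Y' power2_eq_square using S by (intro covariance_combination) auto
  also have "\<dots> = (\<Sum>x\<in>S. \<Sum>y\<in>S. c x * c y * cauchy_kernel \<alpha> (y - x))"
    using inj by (simp add: sum.reindex swap_diff)
  also have "\<dots> = expectation (\<lambda>\<omega>. (\<Sum>x\<in>S. c x * f x \<omega>)\<^sup>2)"
    unfolding power2_eq_square using S by (intro covariance_combination[symmetric])
  finally have v: "expectation (\<lambda>\<omega>. (?Y \<omega>)\<^sup>2) = expectation (\<lambda>\<omega>. (\<Sum>x\<in>S. c x * f x \<omega>)\<^sup>2)" .
  have "?Y \<in> combinations" unfolding Y using S by (intro combinationsI) auto
  from expectation_cos_combination[OF this, of \<theta>]
  show "expectation (\<lambda>\<omega>. cos (\<theta> + ?Y \<omega>)) = cos \<theta> * exp (- expectation (\<lambda>\<omega>. (\<Sum>x\<in>S. c x * f x \<omega>)\<^sup>2) / 2)"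
    unfolding v .
qed (simp_all add: prob_space_axioms)

text \<open>The regression of \<open>f\<close> on \<open>Z\<close>: the residual \<open>f x - \<kappa> x Z\<close> is uncorrelated with \<open>Z\<close>, so the field
  keeps its law when \<open>Z\<close> in the regression term is replaced by an independent copy of itself.  On the
  product space the first coordinate carries the independent \<open>Z\<close> and the second the residual field.\<close>

lemma field_law_resample:
  assumes Z: "Z \<in> combinations" and pos: "expectation (\<lambda>\<omega>. (Z \<omega>)\<^sup>2) > 0"
  defines "\<kappa> \<equiv> \<lambda>x. expectation (\<lambda>\<omega>. Z \<omega> * f x \<omega>) / expectation (\<lambda>\<omega>. (Z \<omega>)\<^sup>2)"
  shows "field_law (M \<Otimes>\<^sub>M M) (\<lambda>x \<omega>. (f x (snd \<omega>) - \<kappa> x * Z (snd \<omega>)) + \<kappa> x * Z (fst \<omega>)) = field_law M f"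
proof (rule field_law_eqI)
  interpret P: pair_prob_space M M ..
  show "prob_space (M \<Otimes>\<^sub>M M)" by (rule P.prob_space_axioms)
  have [measurable]: "Z \<in> borel_measurable M" by (rule measurable_combination[OF Z])
  show "(\<lambda>\<omega>. (f x (snd \<omega>) - \<kappa> x * Z (snd \<omega>)) + \<kappa> x * Z (fst \<omega>)) \<in> borel_measurable (M \<Otimes>\<^sub>M M)" for x
    by measurable
  fix S :: "(real^2) set" and c :: "real^2 \<Rightarrow> real" and \<theta> :: real
  assume S: "finite S"
  define Y where "Y = (\<lambda>\<omega>. \<Sum>x\<in>S. c x * f x \<omega>)"
  define k where "k = (\<Sum>x\<in>S. c x * \<kappa> x)"
  \<comment> \<open>A linear combination of the new field is \<open>V(\<omega>1) + U(\<omega>2)\<close>, with \<open>U + V = Y\<close> and \<open>E[U V] = 0\<close>.\<close>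
  define U where "U = (\<lambda>\<omega>. Y \<omega> + (- k) * Z \<omega>)"
  define V where "V = (\<lambda>\<omega>. k * Z \<omega>)"
  have comb: "Y \<in> combinations" "U \<in> combinations" "V \<in> combinations"
  proof -
    show Y: "Y \<in> combinations" unfolding Y_def by (rule combinationsI[OF S])
    show "U \<in> combinations" unfolding U_def by (intro combinations_add combinations_scale Y Z)
    show "V \<in> combinations" unfolding V_def by (intro combinations_scale Z)
  qed
  have [measurable]: "U \<in> borel_measurable M" "V \<in> borel_measurable M" using comb by (auto intro: measurable_combination)
  have sq: "integrable M (\<lambda>\<omega>. (X \<omega>)\<^sup>2)" if "X \<in> combinations" for X
    using integrable_combination_mult[OF that that] by (simp add: power2_eq_square)
  have YZ: "expectation (\<lambda>\<omega>. Z \<omega> * Y \<omega>) = k * expectation (\<lambda>\<omega>. (Z \<omega>)\<^sup>2)"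
  proof -
    have "expectation (\<lambda>\<omega>. Z \<omega> * Y \<omega>) = expectation (\<lambda>\<omega>. \<Sum>x\<in>S. c x * (Z \<omega> * f x \<omega>))"
      unfolding Y_def by (simp add: sum_distrib_left mult_ac)
    also have "\<dots> = (\<Sum>x\<in>S. c x * expectation (\<lambda>\<omega>. Z \<omega> * f x \<omega>))"
      using Z by (subst Bochner_Integration.integral_sum)
        (auto intro!: integrable_mult_right integrable_combination_mult field_in_combinations)
    also have "\<dots> = k * expectation (\<lambda>\<omega>. (Z \<omega>)\<^sup>2)"
      using pos by (simp add: k_def \<kappa>_def sum_distrib_right)
    finally show ?thesis .
  qed
  have iZY: "integrable M (\<lambda>\<omega>. Z \<omega> * Y \<omega>)" by (rule integrable_combination_mult[OF Z comb(1)])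
  have "(\<lambda>\<omega>. (U \<omega>)\<^sup>2) = (\<lambda>\<omega>. (Y \<omega>)\<^sup>2 - 2 * k * (Z \<omega> * Y \<omega>) + k\<^sup>2 * (Z \<omega>)\<^sup>2)"
    unfolding U_def by (intro ext) (simp add: power2_eq_square algebra_simps)
  hence "expectation (\<lambda>\<omega>. (U \<omega>)\<^sup>2) = expectation (\<lambda>\<omega>. (Y \<omega>)\<^sup>2) - k\<^sup>2 * expectation (\<lambda>\<omega>. (Z \<omega>)\<^sup>2)"
    using iZY sq[OF comb(1)] sq[OF Z] YZ by (simp add: power2_eq_square)
  moreover have "expectation (\<lambda>\<omega>. (V \<omega>)\<^sup>2) = k\<^sup>2 * expectation (\<lambda>\<omega>. (Z \<omega>)\<^sup>2)"
    by (simp add: V_def power_mult_distrib)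
  ultimately have v: "expectation (\<lambda>\<omega>. (Y \<omega>)\<^sup>2) = expectation (\<lambda>\<omega>. (U \<omega>)\<^sup>2) + expectation (\<lambda>\<omega>. (V \<omega>)\<^sup>2)"
    by simp
  have sum: "(\<Sum>x\<in>S. c x * ((f x \<omega>2 - \<kappa> x * Z \<omega>2) + \<kappa> x * Z \<omega>1)) = V \<omega>1 + U \<omega>2" for \<omega>1 \<omega>2
    unfolding U_def V_def Y_def k_def
    by (simp add: algebra_simps sum.distrib sum_subtractf sum_distrib_left sum_distrib_right)
  have "(LINT \<omega>|(M \<Otimes>\<^sub>M M). cos (\<theta> + (V (fst \<omega>) + U (snd \<omega>))))
      = (LINT \<omega>1|M. LINT \<omega>2|M. cos (\<theta> + (V \<omega>1 + U \<omega>2)))"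
    using P.integral_fst'[of "\<lambda>\<omega>. cos (\<theta> + (V (fst \<omega>) + U (snd \<omega>)))"]
    by (subst P.integral_fst'[symmetric]) (auto intro!: P.P.integrable_const_bound[of _ 1])
  also have "\<dots> = (LINT \<omega>1|M. cos (\<theta> + V \<omega>1) * exp (- expectation (\<lambda>\<omega>. (U \<omega>)\<^sup>2) / 2))"
    using expectation_cos_combination[OF comb(2)] by (simp add: add.assoc[symmetric])
  also have "\<dots> = cos \<theta> * exp (- expectation (\<lambda>\<omega>. (V \<omega>)\<^sup>2) / 2) * exp (- expectation (\<lambda>\<omega>. (U \<omega>)\<^sup>2) / 2)"
    using expectation_cos_combination[OF comb(3)] by simp
  also have "\<dots> = cos \<theta> * exp (- expectation (\<lambda>\<omega>. (Y \<omega>)\<^sup>2) / 2)"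
    by (simp add: v mult.assoc add_divide_distrib flip: exp_add)
  finally show "(LINT \<omega>|(M \<Otimes>\<^sub>M M). cos (\<theta> + (\<Sum>x\<in>S. c x * ((f x (snd \<omega>) - \<kappa> x * Z (snd \<omega>)) + \<kappa> x * Z (fst \<omega>)))))
      = cos \<theta> * exp (- expectation (\<lambda>\<omega>. (\<Sum>x\<in>S. c x * f x \<omega>)\<^sup>2) / 2)"
    unfolding sum Y_def .
qed

end

section \<open>Crossing probabilities\<close>

lemma Cross_eq_crossings:
  "Cross M f l R = {\<omega> \<in> space M. \<exists>A\<in>crossings R. \<forall>x\<in>A. f x \<omega> \<le> l}"
proof -
  have "(path_image \<gamma> \<subseteq> {x. f x \<omega> \<le> l} \<inter> {x. x$1 \<in> {0..R} \<and> x$2 \<in> {0..R}} \<and>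
     path_image \<gamma> \<inter> {x. x$1 = 0 \<and> x$2 \<in> {0..R}} \<noteq> {} \<and>
     path_image \<gamma> \<inter> {x. x$1 = R \<and> x$2 \<in> {0..R}} \<noteq> {}) \<longleftrightarrow>
     (path_image \<gamma> \<subseteq> square R \<and> (\<exists>x\<in>path_image \<gamma>. x$1 = 0) \<and> (\<exists>x\<in>path_image \<gamma>. x$1 = R)) \<and>
     (\<forall>x\<in>path_image \<gamma>. f x \<omega> \<le> l)" for \<gamma> :: "real \<Rightarrow> real^2" and \<omega>
    unfolding square_def by blast
  thus ?thesis unfolding Cross_def crossings_def by (simp only:) blast
qed

context cauchy_field
begin

lemma field_level_distribution:
  assumes R: "R \<ge> 0" and N: "prob_space N" and [measurable]: "\<And>x. Y x \<in> borel_measurable N"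
    and law: "field_law N Y = field_law M f" and B [measurable]: "B \<in> sets borel"
  shows "measure N {\<omega>\<in>space N. crossing_level R (\<lambda>x. Y x \<omega>) \<in> B}
    = prob {\<omega>\<in>space M. crossing_level R (\<lambda>x. f x \<omega>) \<in> B}"
proof -
  have L: "crossing_level R -` B \<inter> space (\<Pi>\<^sub>M x\<in>UNIV. borel) \<in> sets (\<Pi>\<^sub>M x\<in>UNIV. borel)"
    by (rule measurable_sets[OF measurable_crossing_level[OF R] B])
  have Y: "(\<lambda>\<omega> x. Y x \<omega>) \<in> measurable N (\<Pi>\<^sub>M x\<in>UNIV. borel)"
    by (rule measurable_PiM_single') auto
  have f: "(\<lambda>\<omega> x. f x \<omega>) \<in> measurable M (\<Pi>\<^sub>M x\<in>UNIV. borel)"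
    by (rule measurable_PiM_single') auto
  have "measure (field_law N Y) (crossing_level R -` B \<inter> space (\<Pi>\<^sub>M x\<in>UNIV. borel))
      = measure N {\<omega>\<in>space N. crossing_level R (\<lambda>x. Y x \<omega>) \<in> B}"
    unfolding field_law_def measure_distr[OF Y L] by (rule arg_cong[where f="measure N"]) (auto simp: space_PiM)
  moreover have "measure (field_law M f) (crossing_level R -` B \<inter> space (\<Pi>\<^sub>M x\<in>UNIV. borel))
      = prob {\<omega>\<in>space M. crossing_level R (\<lambda>x. f x \<omega>) \<in> B}"
    unfolding field_law_def measure_distr[OF f L] by (rule arg_cong[where f="measure M"]) (auto simp: space_PiM)
  ultimately show ?thesis using law by simp
qed

lemma measurable_crossing_level_comp:
  assumes R: "R \<ge> 0" and "\<And>x. Y x \<in> borel_measurable N"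
  shows "(\<lambda>\<omega>. crossing_level R (\<lambda>x. Y x \<omega>)) \<in> borel_measurable N"
proof (rule measurable_compose[OF _ measurable_crossing_level[OF R]])
  show "(\<lambda>\<omega> x. Y x \<omega>) \<in> measurable N (\<Pi>\<^sub>M x\<in>UNIV. borel)"
    by (rule measurable_PiM_single') (use assms(2) in auto)
qed

text \<open>By duality one of \<open>f\<close> and its negated reflection has a nonpositive crossing level, and
  both events have the same probability.\<close>

lemma prob_crossing_level_nonpos:
  assumes R: "R \<ge> 0"
  shows "prob {\<omega>\<in>space M. crossing_level R (\<lambda>x. f x \<omega>) \<le> 0} \<ge> 1/2"
proof -
  let ?A = "{\<omega>\<in>space M. crossing_level R (\<lambda>x. f x \<omega>) \<in> {..0}}"
  let ?B = "{\<omega>\<in>space M. crossing_level R (\<lambda>x. - f (swap x) \<omega>) \<in> {..0}}"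
  have [measurable]: "(\<lambda>\<omega>. crossing_level R (\<lambda>x. f x \<omega>)) \<in> borel_measurable M"
    "(\<lambda>\<omega>. crossing_level R (\<lambda>x. - f (swap x) \<omega>)) \<in> borel_measurable M"
    by (intro measurable_crossing_level_comp[OF R]; simp)+
  have "AE \<omega> in M. \<omega> \<in> ?A \<union> ?B"
    using continuous AE_space
  proof eventually_elim
    case (elim \<omega>)
    have c: "continuous_on (square R) (\<lambda>x. f x \<omega>)"
      using elim continuous_on_subset by blast
    have "continuous_on (square R) (\<lambda>x. - f (swap x) \<omega>)"
      using continuous_on_compose2[OF elim(1) continuous_on_swap[of "square R"]] by (intro continuous_intros) auto
    thus ?case using minimax_duality[OF R c] elim(2) c R by (auto simp: crossing_level_eq_minimax)
  qed
  hence "1 = prob (?A \<union> ?B)" by (subst prob_eq_1[THEN iffD2]) auto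
  also have "\<dots> \<le> prob ?A + prob ?B" by (rule measure_Un_le) auto
  also have "prob ?B = prob ?A"
    by (rule field_level_distribution[OF R prob_space_axioms]) (auto simp: field_law_negate_swap)
  finally show ?thesis by simp
qed

text \<open>Work on the product space of \<open>field_law_resample\<close> with the residual field fixed.  The crossing level
  grows with \<open>Z\<close> at least at rate \<open>m / v\<close>, where \<open>v = E[Z\<^sup>2]\<close>, so it can lie in an interval of length
  \<open>h\<close> only while \<open>Z\<close> stays in a set of diameter \<open>h v / m\<close>.  Such a set has Gaussian measure at
  most \<open>(h v / m) / sqrt v\<close>; integrate over the residual.\<close>

lemma prob_crossing_level_interval:
  assumes R: "R \<ge> 0" and S: "finite S" and Z: "Z = (\<lambda>\<omega>. \<Sum>s\<in>S. c s * f s \<omega>)"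
    and m: "m > 0" "\<And>x. x \<in> square R \<Longrightarrow> expectation (\<lambda>\<omega>. Z \<omega> * f x \<omega>) \<ge> m"
    and pos: "expectation (\<lambda>\<omega>. (Z \<omega>)\<^sup>2) > 0" and h: "h \<ge> 0"
  shows "prob {\<omega>\<in>space M. crossing_level R (\<lambda>x. f x \<omega>) \<in> {a..a+h}}
    \<le> h * sqrt (expectation (\<lambda>\<omega>. (Z \<omega>)\<^sup>2)) / m"
proof -
  interpret crossing_family "crossings R" "square R" by (rule crossing_family_crossings[OF R])
  interpret P: pair_prob_space M M ..
  define v where "v = expectation (\<lambda>\<omega>. (Z \<omega>)\<^sup>2)"
  define \<kappa> where "\<kappa> x = expectation (\<lambda>\<omega>. Z \<omega> * f x \<omega>) / v" for x
  define Y where "Y x \<omega> = (f x (snd \<omega>) - \<kappa> x * Z (snd \<omega>)) + \<kappa> x * Z (fst \<omega>)" for x \<omega>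
  have v: "v > 0" using pos by (simp add: v_def)
  have Zc: "Z \<in> combinations" unfolding Z by (rule combinationsI[OF S])
  have [measurable]: "Z \<in> borel_measurable M" by (rule measurable_combination[OF Zc])
  have Ym [measurable]: "Y x \<in> borel_measurable (M \<Otimes>\<^sub>M M)" for x unfolding Y_def by measurable
  have law: "field_law (M \<Otimes>\<^sub>M M) Y = field_law M f"
    using field_law_resample[OF Zc pos] unfolding Y_def \<kappa>_def v_def .
  have \<kappa>_cont: "continuous_on T \<kappa>" for T
  proof -
    have "\<kappa> x = (\<Sum>s\<in>S. c s * cauchy_kernel \<alpha> (x - s)) / v" for x
      using covariance_combination[OF S, of "{x}" c "\<lambda>_. 1"] by (simp add: \<kappa>_def Z)
    hence "\<kappa> = (\<lambda>x. (\<Sum>s\<in>S. c s * cauchy_kernel \<alpha> (x - s)) / v)" by blast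
    thus ?thesis using v by (auto intro!: continuous_intros)
  qed
  have \<kappa>_ge: "\<kappa> x \<ge> m / v" if "x \<in> square R" for x
    using m(2)[OF that] v by (simp add: \<kappa>_def divide_right_mono)
  let ?I = "{a..a+h}"
  let ?E = "{\<omega>\<in>space (M \<Otimes>\<^sub>M M). crossing_level R (\<lambda>x. Y x \<omega>) \<in> ?I}"
  have [measurable]: "(\<lambda>\<omega>. crossing_level R (\<lambda>x. Y x \<omega>)) \<in> borel_measurable (M \<Otimes>\<^sub>M M)"
    by (rule measurable_crossing_level_comp[OF R Ym])
  have E: "?E \<in> sets (M \<Otimes>\<^sub>M M)" by measurable
  define d where "d = h * v / m"
  have d: "d \<ge> 0" using h v m by (simp add: d_def)
  have slice_le: "emeasure M ((\<lambda>\<omega>1. (\<omega>1, \<omega>2)) -` ?E) \<le> ennreal (d / sqrt v)"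
    if cont: "continuous_on UNIV (\<lambda>x. f x \<omega>2)" and \<omega>2: "\<omega>2 \<in> space M" for \<omega>2
  proof -
    let ?F = "\<lambda>\<omega>1 x. Y x (\<omega>1, \<omega>2)"
    have c: "continuous_on (square R) (?F \<omega>1)" for \<omega>1
      unfolding Y_def using continuous_on_subset[OF cont, of "square R"] \<kappa>_cont
      by (auto intro!: continuous_intros)
    note b = bounded_continuous_square[OF c]
    have gap: "crossing_level R (?F \<omega>1) + (Z \<omega>1' - Z \<omega>1) * (m / v) \<le> crossing_level R (?F \<omega>1')"
      if "Z \<omega>1 \<le> Z \<omega>1'" for \<omega>1 \<omega>1'
    proof -
      have "?F \<omega>1 x \<le> ?F \<omega>1' x + - ((Z \<omega>1' - Z \<omega>1) * (m / v))" if "x \<in> square R" for x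
      proof -
        have "(Z \<omega>1' - Z \<omega>1) * (m / v) \<le> (Z \<omega>1' - Z \<omega>1) * \<kappa> x"
          using \<kappa>_ge[OF that] \<open>Z \<omega>1 \<le> Z \<omega>1'\<close> by (intro mult_left_mono) auto
        thus ?thesis by (simp add: Y_def algebra_simps)
      qed
      from minimax_mono_shift[OF b b this] show ?thesis
        by (simp add: crossing_level_eq_minimax[OF R c])
    qed
    have diam: "\<bar>Z \<omega>1' - Z \<omega>1\<bar> \<le> d"
      if "crossing_level R (?F \<omega>1) \<in> ?I" "crossing_level R (?F \<omega>1') \<in> ?I" for \<omega>1 \<omega>1'
    proof -
      have "\<bar>Z \<omega>1' - Z \<omega>1\<bar> * (m / v) \<le> h"
        using gap[of \<omega>1 \<omega>1'] gap[of \<omega>1' \<omega>1] that by (cases "Z \<omega>1 \<le> Z \<omega>1'") auto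
      thus ?thesis using m v by (simp add: d_def field_simps)
    qed
    show ?thesis
    proof (cases "\<exists>\<omega>0\<in>space M. crossing_level R (?F \<omega>0) \<in> ?I")
      case False
      hence empty: "(\<lambda>\<omega>1. (\<omega>1, \<omega>2)) -` ?E = {}" by (auto simp: space_pair_measure)
      show ?thesis unfolding empty by simp
    next
      case True
      then obtain \<omega>0 where \<omega>0: "crossing_level R (?F \<omega>0) \<in> ?I" by blast
      have "(\<lambda>\<omega>1. (\<omega>1, \<omega>2)) -` ?E \<subseteq> {\<omega>\<in>space M. \<bar>Z \<omega> - Z \<omega>0\<bar> \<le> d}"
        using diam[OF \<omega>0] by (auto simp: space_pair_measure)
      hence "emeasure M ((\<lambda>\<omega>1. (\<omega>1, \<omega>2)) -` ?E) \<le> emeasure M {\<omega>\<in>space M. \<bar>Z \<omega> - Z \<omega>0\<bar> \<le> d}"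
        by (intro emeasure_mono) auto
      also have "\<dots> = ennreal (prob {\<omega>\<in>space M. \<bar>Z \<omega> - Z \<omega>0\<bar> \<le> d})" by (rule emeasure_eq_measure)
      also have "\<dots> \<le> ennreal (d / sqrt v)"
        unfolding v_def by (intro ennreal_leI centred_gaussian_moments(3) gaussian_combination
          expectation_combination Zc pos d)
      finally show ?thesis .
    qed
  qed
  have "emeasure (M \<Otimes>\<^sub>M M) ?E = (\<integral>\<^sup>+\<omega>2. emeasure M ((\<lambda>\<omega>1. (\<omega>1, \<omega>2)) -` ?E) \<partial>M)"
    by (rule P.emeasure_pair_measure_alt2[OF E])
  also have "\<dots> \<le> (\<integral>\<^sup>+\<omega>2. ennreal (d / sqrt v) \<partial>M)"
  proof (rule nn_integral_mono_AE)
    show "AE \<omega>2 in M. emeasure M ((\<lambda>\<omega>1. (\<omega>1, \<omega>2)) -` ?E) \<le> ennreal (d / sqrt v)"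
      using continuous AE_space by eventually_elim (rule slice_le)
  qed
  also have "\<dots> = ennreal (d / sqrt v)" by (simp add: emeasure_space_1)
  finally have "measure (M \<Otimes>\<^sub>M M) ?E \<le> d / sqrt v"
    using d v by (simp add: P.emeasure_eq_measure)
  also have "d / sqrt v = h * sqrt v / m"
    using v m real_sqrt_mult_self[of v] by (simp add: d_def field_simps)
  also have "measure (M \<Otimes>\<^sub>M M) ?E = prob {\<omega>\<in>space M. crossing_level R (\<lambda>x. f x \<omega>) \<in> ?I}"
    by (rule field_level_distribution[OF R P.prob_space_axioms Ym law]) simp
  finally show ?thesis by (simp add: v_def)
qed

text \<open>The case \<open>h = 0\<close> of the interval bound shows that the crossing level has no atom at \<open>l\<close>.
  Hence \<open>Cross\<close>, which lies between \<open>{T < l}\<close> and \<open>{T \<le> l}\<close> up to a null set, belongs to the completed sigma-algebra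
  and has the probability of \<open>{T < l}\<close>, which is at least that of \<open>{T \<le> 0}\<close> minus that of \<open>{l \<le> T \<le> 0}\<close>.\<close>

lemma prob_Cross_ge:
  assumes R: "R \<ge> 0" and S: "finite S" and Z: "Z = (\<lambda>\<omega>. \<Sum>s\<in>S. c s * f s \<omega>)"
    and m: "m > 0" "\<And>x. x \<in> square R \<Longrightarrow> expectation (\<lambda>\<omega>. Z \<omega> * f x \<omega>) \<ge> m"
    and pos: "expectation (\<lambda>\<omega>. (Z \<omega>)\<^sup>2) > 0" and l: "l \<le> 0"
  shows "measure (completion M) (Cross M f l R)
    \<ge> 1/2 - \<bar>l\<bar> * sqrt (expectation (\<lambda>\<omega>. (Z \<omega>)\<^sup>2)) / m"
proof -
  interpret crossing_family "crossings R" "square R" by (rule crossing_family_crossings[OF R])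
  let ?L = "\<lambda>\<omega>. crossing_level R (\<lambda>x. f x \<omega>)"
  note interval = prob_crossing_level_interval[OF R S Z m pos]
  have [measurable]: "?L \<in> borel_measurable M" by (rule measurable_crossing_level_comp[OF R measurable_field])
  have atom: "prob {\<omega>\<in>space M. ?L \<omega> = l} = 0"
    using interval[of 0 l] by (simp add: measure_le_0_iff)
  obtain N where N: "N \<in> null_sets M" "\<And>\<omega>. \<omega> \<in> space M \<Longrightarrow> \<omega> \<notin> N \<Longrightarrow> continuous_on UNIV (\<lambda>x. f x \<omega>)"
    using continuous by (auto elim!: AE_E simp: null_sets_def)
  have N' [measurable]: "N \<in> sets M" using N by auto
  let ?A = "{\<omega>\<in>space M. ?L \<omega> < l} - N" and ?B = "{\<omega>\<in>space M. ?L \<omega> \<le> l} \<union> N"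
  have A: "?A \<subseteq> Cross M f l R"
  proof
    fix \<omega> assume \<omega>: "\<omega> \<in> ?A"
    hence c: "continuous_on (square R) (\<lambda>x. f x \<omega>)" using N(2) continuous_on_subset by blast
    have "minimax (crossings R) (\<lambda>x. f x \<omega>) < l" using \<omega> by (simp add: crossing_level_eq_minimax[OF R c])
    then obtain A where "A \<in> crossings R" "\<And>x. x \<in> A \<Longrightarrow> f x \<omega> < l"
      using minimax_less[OF bounded_continuous_square[OF c]] by blast
    thus "\<omega> \<in> Cross M f l R" using \<omega> unfolding Cross_eq_crossings by (auto intro!: bexI[of _ A] less_imp_le)
  qed
  have B: "Cross M f l R \<subseteq> ?B"
  proof
    fix \<omega> assume \<omega>: "\<omega> \<in> Cross M f l R"
    show "\<omega> \<in> ?B"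
    proof (cases "\<omega> \<in> N")
      case False
      have sp: "\<omega> \<in> space M" using \<omega> by (simp add: Cross_def)
      hence c: "continuous_on (square R) (\<lambda>x. f x \<omega>)" using N(2) False continuous_on_subset by blast
      obtain A where "A \<in> crossings R" "\<forall>x\<in>A. f x \<omega> \<le> l" using \<omega> unfolding Cross_eq_crossings by blast
      hence "minimax (crossings R) (\<lambda>x. f x \<omega>) \<le> l"
        by (intro minimax_le[OF bounded_continuous_square[OF c]]) auto
      thus ?thesis using sp by (simp add: crossing_level_eq_minimax[OF R c])
    qed simp
  qed
  have pA: "prob ?A = prob {\<omega>\<in>space M. ?L \<omega> < l}"
    using N(1) by (intro measure_Diff_null_set) auto
  have "{\<omega>\<in>space M. ?L \<omega> \<le> l} = {\<omega>\<in>space M. ?L \<omega> < l} \<union> {\<omega>\<in>space M. ?L \<omega> = l}" by auto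
  moreover have "prob ({\<omega>\<in>space M. ?L \<omega> < l} \<union> {\<omega>\<in>space M. ?L \<omega> = l})
      = prob {\<omega>\<in>space M. ?L \<omega> < l} + prob {\<omega>\<in>space M. ?L \<omega> = l}"
    by (intro finite_measure_Union) auto
  moreover have "prob ?B = prob {\<omega>\<in>space M. ?L \<omega> \<le> l}"
    using N(1) by (intro measure_Un_null_set) auto
  ultimately have pB: "prob ?B = prob ?A" using pA atom by simp
  interpret C: prob_space "completion M"
    by (rule prob_spaceI) (simp add: emeasure_space_1)
  have "Cross M f l R \<in> sets (completion M)"
  proof (rule completion.complete_sets_sandwich[OF _ _ A B])
    show "emeasure (completion M) ?A = emeasure (completion M) ?B"
      using pB by (simp add: emeasure_eq_measure)
  qed (auto intro: sets_completionI_sets simp: emeasure_eq_measure)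
  hence "measure (completion M) ?A \<le> measure (completion M) (Cross M f l R)"
    by (intro C.finite_measure_mono A)
  hence 1: "prob {\<omega>\<in>space M. ?L \<omega> < l} \<le> measure (completion M) (Cross M f l R)"
    using pA by simp
  have "1/2 \<le> prob {\<omega>\<in>space M. ?L \<omega> \<le> 0}" by (rule prob_crossing_level_nonpos[OF R])
  also have "{\<omega>\<in>space M. ?L \<omega> \<le> 0} = {\<omega>\<in>space M. ?L \<omega> < l} \<union> {\<omega>\<in>space M. ?L \<omega> \<in> {l..l+\<bar>l\<bar>}}"
    using l by auto
  also have "prob \<dots> \<le> prob {\<omega>\<in>space M. ?L \<omega> < l} + prob {\<omega>\<in>space M. ?L \<omega> \<in> {l..l+\<bar>l\<bar>}}"
    by (intro measure_Un_le) auto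
  also have "prob {\<omega>\<in>space M. ?L \<omega> \<in> {l..l+\<bar>l\<bar>}} \<le> \<bar>l\<bar> * sqrt (expectation (\<lambda>\<omega>. (Z \<omega>)\<^sup>2)) / m"
    by (rule interval) simp_all
  finally show ?thesis using 1 by simp
qed

end

section \<open>Averages of the Cauchy kernel along an axis\<close>

definition axis_point :: "nat \<Rightarrow> real^2" where
  "axis_point k = (\<chi> i. if i = 1 then real k else 0)"

lemma axis_point_nth [simp]: "axis_point k $ 1 = real k" "axis_point k $ 2 = 0"
  by (simp_all add: axis_point_def)

lemma inj_axis_point: "inj axis_point"
  by (rule injI) (metis axis_point_nth(1) of_nat_eq_iff)

lemma norm2_eq: "(norm (x :: real^2))\<^sup>2 = (x$1)\<^sup>2 + (x$2)\<^sup>2"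
  by (simp add: norm_vec_def L2_set_def sum_2)

text \<open>The right-hand side is chosen so that it sums to a harmonic number for all \<open>\<alpha> \<le> 1\<close> at once, at the
  cost of a logarithm: it uses \<open>(k + 1) powr (1 - \<alpha>) \<le> n powr (1 - \<alpha>)\<close>.\<close>

lemma kernel_le:
  assumes \<alpha>: "0 < \<alpha>" "\<alpha> \<le> 1" and k: "k < n"
  shows "(1 + (real k)\<^sup>2) powr (-\<alpha>/2) \<le> 2 * real n powr (1 - \<alpha>) * inverse (real (Suc k))"
proof -
  let ?j = "real (Suc k)"
  have "2 * real k \<le> (real k)\<^sup>2 + 1" using sum_squares_bound[of "real k" 1] by simp
  hence "(?j / 2)\<^sup>2 \<le> 1 + (real k)\<^sup>2"
    by (simp add: power2_eq_square field_simps)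
  hence "(1 + (real k)\<^sup>2) powr (-\<alpha>/2) \<le> ((?j / 2)\<^sup>2) powr (-\<alpha>/2)"
    using \<alpha> by (intro powr_mono2') auto
  also have "\<dots> = (?j / 2) powr (-\<alpha>)"
    by (simp add: powr_powr flip: powr_numeral)
  also have "\<dots> = 2 powr \<alpha> * ?j powr (-\<alpha>)"
    by (simp add: powr_divide powr_minus field_simps)
  also have "\<dots> \<le> 2 powr 1 * ?j powr (-\<alpha>)"
    using \<alpha> by (intro mult_right_mono powr_mono) auto
  also have "?j powr (-\<alpha>) = ?j powr (1 - \<alpha>) * inverse ?j"
    using powr_add[of ?j "1 - \<alpha>" "-1"] by (simp add: powr_minus)
  also have "2 powr 1 * (?j powr (1 - \<alpha>) * inverse ?j) \<le> 2 powr 1 * (real n powr (1 - \<alpha>) * inverse ?j)"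
    using \<alpha> k by (intro mult_left_mono mult_right_mono powr_mono2) auto
  finally show ?thesis by simp
qed

lemma kernel_sum_le:
  assumes \<alpha>: "0 < \<alpha>" "\<alpha> \<le> 1" and n: "n \<ge> 1"
  shows "(\<Sum>k<n. (1 + (real k)\<^sup>2) powr (-\<alpha>/2)) \<le> 2 * real n powr (1 - \<alpha>) * (1 + ln n)"
proof -
  have "(\<Sum>k<n. (1 + (real k)\<^sup>2) powr (-\<alpha>/2)) \<le> (\<Sum>k<n. 2 * real n powr (1 - \<alpha>) * inverse (real (Suc k)))"
    by (intro sum_mono kernel_le \<alpha>) auto
  also have "\<dots> = 2 * real n powr (1 - \<alpha>) * harm n"
    by (simp add: harm_altdef sum_distrib_left)
  also have "\<dots> \<le> 2 * real n powr (1 - \<alpha>) * (1 + ln n)"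
  proof (rule mult_left_mono)
    show "harm n \<le> 1 + ln n"
      using euler_mascheroni_sequence_decreasing[of 1 n] n by (simp add: harm_expand)
  qed simp
  finally show ?thesis .
qed

text \<open>Split the row at the diagonal; each half is an initial piece of the one-sided sum.\<close>

lemma toeplitz_row_le:
  fixes \<phi> :: "real \<Rightarrow> real"
  assumes nonneg: "\<And>t. \<phi> t \<ge> 0" and even: "\<And>t. \<phi> (- t) = \<phi> t" and i: "i < n"
  shows "(\<Sum>j<n. \<phi> (real j - real i)) \<le> 2 * (\<Sum>k<n. \<phi> (real k))"
proof -
  have "(\<Sum>j<n. \<phi> (real j - real i)) \<le> (\<Sum>j\<in>{..i}. \<phi> (real j - real i)) + (\<Sum>j\<in>{i..<n}. \<phi> (real j - real i))"
  proof -
    have "{..<n} = {..i} \<union> {i..<n}" using i by auto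
    thus ?thesis using nonneg by (simp add: sum_Un sum_nonneg)
  qed
  also have "(\<Sum>j\<in>{..i}. \<phi> (real j - real i)) = (\<Sum>k\<in>{..i}. \<phi> (real k))"
    by (rule sum.reindex_bij_witness[of _ "\<lambda>k. i - k" "\<lambda>k. i - k"])
       (auto simp: of_nat_diff even[symmetric, of "real i - real _"] intro: arg_cong[where f=\<phi>] even[symmetric, of "_ - _", simplified])
  also have "\<dots> \<le> (\<Sum>k<n. \<phi> (real k))"
    using i nonneg by (intro sum_mono2) auto
  also have "(\<Sum>j\<in>{i..<n}. \<phi> (real j - real i)) = (\<Sum>k\<in>{..<n-i}. \<phi> (real k))"
    by (rule sum.reindex_bij_witness[of _ "\<lambda>k. k + i" "\<lambda>j. j - i"]) (auto simp: of_nat_diff)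
  also have "\<dots> \<le> (\<Sum>k<n. \<phi> (real k))"
    using nonneg by (intro sum_mono2) auto
  finally show ?thesis by simp
qed

lemma cauchy_kernel_lower:
  assumes x: "x \<in> square R" and n: "R + 1 \<le> real n" and k: "k < n" and \<alpha>: "\<alpha> > 0"
  shows "(3 * (real n)\<^sup>2) powr (-\<alpha>/2) \<le> cauchy_kernel \<alpha> (x - axis_point k)"
proof -
  have "0 \<le> x$1" "x$1 \<le> real n" "0 \<le> x$2" "x$2 \<le> real n" "1 \<le> real n"
    using x n k by (auto simp: square_def)
  hence "(x$1 - real k)\<^sup>2 \<le> (real n)\<^sup>2" "(x$2)\<^sup>2 \<le> (real n)\<^sup>2" "1 \<le> (real n)\<^sup>2"
    using k by (auto intro!: abs_le_square_iff[THEN iffD1] power_mono one_le_power)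
  hence "1 + (norm (x - axis_point k))\<^sup>2 \<le> 3 * (real n)\<^sup>2"
    by (simp add: norm2_eq)
  thus ?thesis unfolding cauchy_kernel_def using \<alpha>
    by (intro powr_mono2') (auto intro: add_pos_nonneg)
qed

context cauchy_field
begin

text \<open>Take for \<open>Z\<close> the average of the field over the points \<open>0, \<dots>, n - 1\<close> of the first axis, where
  \<open>n - 1\<close> is \<open>R\<close> rounded up.  Then \<open>m = (3 n\<^sup>2) powr (-\<alpha>/2)\<close>, because all distances to points of the
  square are at most \<open>sqrt 2 * n\<close>, and the variance of \<open>Z\<close> is at most \<open>4 n powr (-\<alpha>) (1 + ln n)\<close>.\<close>

lemma prob_Cross_lower_bound:
  assumes \<alpha>: "0 < \<alpha>" "\<alpha> \<le> 1" and R: "R \<ge> 0" and l: "l \<le> 0"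
  shows "measure (completion M) (Cross M f l R)
    \<ge> 1/2 - 4 * \<bar>l\<bar> * (R + 2) powr (\<alpha>/2) * sqrt (1 + ln (R + 2))"
proof -
  define n where "n = Suc (nat \<lceil>R\<rceil>)"
  have n: "n \<ge> 1" "R + 1 \<le> real n" "real n \<le> R + 2"
    using R by (auto simp: n_def) linarith+
  define S where "S = axis_point ` {..<n}"
  define Z where "Z = (\<lambda>\<omega>. \<Sum>s\<in>S. 1 / real n * f s \<omega>)"
  define m where "m = (3 * (real n)\<^sup>2) powr (-\<alpha>/2)"
  define v where "v = expectation (\<lambda>\<omega>. (Z \<omega>)\<^sup>2)"
  let ?\<phi> = "\<lambda>t::real. (1 + t\<^sup>2) powr (-\<alpha>/2)"
  have inj: "inj_on axis_point {..<n}" using inj_axis_point inj_on_subset by blast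
  have S: "finite S" by (simp add: S_def)
  have m0: "m > 0" using n by (simp add: m_def)
  have m_le: "m \<le> expectation (\<lambda>\<omega>. Z \<omega> * f x \<omega>)" if x: "x \<in> square R" for x
  proof -
    have "expectation (\<lambda>\<omega>. Z \<omega> * f x \<omega>) = (\<Sum>s\<in>S. 1 / real n * cauchy_kernel \<alpha> (x - s))"
      using covariance_combination[OF S, of "{x}" "\<lambda>_. 1 / real n" "\<lambda>_. 1"] by (simp add: Z_def)
    also have "\<dots> = (\<Sum>k<n. 1 / real n * cauchy_kernel \<alpha> (x - axis_point k))"
      using inj by (simp add: S_def sum.reindex)
    also have "\<dots> \<ge> (\<Sum>k<n. 1 / real n * m)"
      unfolding m_def using \<alpha> n by (intro sum_mono mult_left_mono cauchy_kernel_lower[OF x]) auto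
    finally show ?thesis using n by simp
  qed
  have v_eq: "v = 1 / (real n)\<^sup>2 * (\<Sum>i<n. \<Sum>j<n. ?\<phi> (real j - real i))"
  proof -
    have "v = (\<Sum>x\<in>S. \<Sum>y\<in>S. 1 / real n * (1 / real n) * cauchy_kernel \<alpha> (y - x))"
      unfolding v_def Z_def power2_eq_square by (rule covariance_combination[OF S S])
    also have "\<dots> = (\<Sum>i<n. \<Sum>j<n. 1 / (real n)\<^sup>2 * ?\<phi> (real j - real i))"
    proof -
      have "cauchy_kernel \<alpha> (axis_point j - axis_point i) = ?\<phi> (real j - real i)" for i j
        by (simp add: cauchy_kernel_def norm2_eq)
      thus ?thesis unfolding S_def using inj
        by (simp add: sum.reindex) (simp add: power2_eq_square[of "real n"])
    qed
    finally show ?thesis by (simp add: sum_distrib_left)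
  qed
  have \<phi>_pos: "?\<phi> t > 0" for t
  proof -
    have "1 + t\<^sup>2 \<noteq> 0" using zero_le_power2[of t] by linarith
    thus ?thesis by simp
  qed
  have v_pos: "v > 0"
  proof -
    have "0 < (\<Sum>i<n. \<Sum>j<n. ?\<phi> (real j - real i))"
      using n \<phi>_pos by (intro sum_pos) (auto simp: lessThan_empty_iff)
    thus ?thesis unfolding v_eq using n by simp
  qed
  have v_le: "v \<le> 4 * real n powr (-\<alpha>) * (1 + ln n)"
  proof -
    have "(\<Sum>i<n. \<Sum>j<n. ?\<phi> (real j - real i)) \<le> (\<Sum>i<n. 2 * (2 * real n powr (1 - \<alpha>) * (1 + ln n)))"
    proof (rule sum_mono)
      fix i assume "i \<in> {..<n}"
      hence "(\<Sum>j<n. ?\<phi> (real j - real i)) \<le> 2 * (\<Sum>k<n. ?\<phi> (real k))"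
        by (intro toeplitz_row_le) auto
      also have "\<dots> \<le> 2 * (2 * real n powr (1 - \<alpha>) * (1 + ln n))"
        by (intro mult_left_mono kernel_sum_le \<alpha> n) auto
      finally show "(\<Sum>j<n. ?\<phi> (real j - real i)) \<le> 2 * (2 * real n powr (1 - \<alpha>) * (1 + ln n))" .
    qed
    hence "v \<le> 1 / (real n)\<^sup>2 * (\<Sum>i<n. 2 * (2 * real n powr (1 - \<alpha>) * (1 + ln n)))"
      unfolding v_eq by (intro mult_left_mono) auto
    also have "\<dots> = 4 * (real n powr (1 - \<alpha>) / real n) * (1 + ln n)"
      using n by (simp add: power2_eq_square)
    also have "real n powr (1 - \<alpha>) / real n = real n powr (-\<alpha>)"
      using n powr_diff[of "real n" "1 - \<alpha>" 1] by simp
    finally show ?thesis .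
  qed
  have "sqrt v / m \<le> 4 * real n powr (\<alpha>/2) * sqrt (1 + ln n)"
  proof -
    have "sqrt v \<le> sqrt (4 * real n powr (-\<alpha>) * (1 + ln n))" using v_le by simp
    also have "\<dots> = 2 * real n powr (-\<alpha>/2) * sqrt (1 + ln n)"
    proof -
      have "sqrt (real n powr (-\<alpha>)) = real n powr (-\<alpha>/2)"
        by (simp add: powr_powr flip: powr_half_sqrt)
      thus ?thesis by (simp add: real_sqrt_mult)
    qed
    finally have 1: "sqrt v \<le> 2 * real n powr (-\<alpha>/2) * sqrt (1 + ln n)" .
    have "1 / m = (3 * (real n)\<^sup>2) powr (\<alpha>/2)"
      by (simp add: m_def powr_minus_divide)
    also have "\<dots> = 3 powr (\<alpha>/2) * real n powr \<alpha>"
      using n by (simp add: powr_mult powr_powr flip: powr_numeral)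
    also have "\<dots> \<le> 2 * real n powr \<alpha>"
    proof -
      have "3 powr (\<alpha>/2) \<le> 3 powr (1/2::real)" using \<alpha> by (intro powr_mono) auto
      also have "\<dots> \<le> 2" by (simp add: powr_half_sqrt real_le_lsqrt)
      finally show ?thesis by (intro mult_right_mono) auto
    qed
    finally have 2: "1 / m \<le> 2 * real n powr \<alpha>" .
    have "sqrt v * (1 / m) \<le> (2 * real n powr (-\<alpha>/2) * sqrt (1 + ln n)) * (2 * real n powr \<alpha>)"
      using 1 2 m0 v_pos n by (intro mult_mono) auto
    also have "\<dots> = 4 * (real n powr (-\<alpha>/2) * real n powr \<alpha>) * sqrt (1 + ln n)" by simp
    also have "real n powr (-\<alpha>/2) * real n powr \<alpha> = real n powr (\<alpha>/2)"
      by (simp flip: powr_add)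
    finally show ?thesis by simp
  qed
  also have "\<dots> \<le> 4 * (R + 2) powr (\<alpha>/2) * sqrt (1 + ln (R + 2))"
    using n \<alpha> R by (intro mult_mono powr_mono2 real_sqrt_le_mono) auto
  finally have "\<bar>l\<bar> * (sqrt v / m) \<le> \<bar>l\<bar> * (4 * (R + 2) powr (\<alpha>/2) * sqrt (1 + ln (R + 2)))"
    by (rule mult_left_mono) simp
  moreover have "measure (completion M) (Cross M f l R) \<ge> 1/2 - \<bar>l\<bar> * sqrt v / m"
    unfolding v_def using prob_Cross_ge[OF R S Z_def m0 m_le _ l] v_pos by (simp add: v_def)
  ultimately show ?thesis by (simp add: mult_ac)
qed

end

section \<open>The correlation length\<close>

lemma crossing_error_tendsto_0:
  assumes "0 < \<alpha>" "0 < q" "q * \<alpha> < 2"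
  shows "((\<lambda>s::real. 4 * s * (s powr (-q) + 2) powr (\<alpha>/2) * sqrt (1 + ln (s powr (-q) + 2))) \<longlongrightarrow> 0) (at_right 0)"
proof -
  have "1 - q * \<alpha> / 2 > 0" using assms by simp
  show ?thesis using assms \<open>1 - q * \<alpha> / 2 > 0\<close> by real_asymp
qed

text \<open>For \<open>R < \<bar>l\<bar> powr (-q)\<close> the error term in \<open>prob_Cross_lower_bound\<close> is at most its value at
  \<open>R = \<bar>l\<bar> powr (-q)\<close>, which tends to zero; so no such \<open>R\<close> can belong to the set of which \<open>xi\<close> is the infimum.\<close>

lemma (in cauchy_field) eventually_xi_ge:
  assumes \<alpha>: "0 < \<alpha>" "\<alpha> \<le> 1" and q: "0 < q" "q < 2 / \<alpha>" and \<epsilon>: "\<epsilon> < 1/2"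
  shows "\<forall>\<^sub>F l in at_left 0. xi M f \<epsilon> l \<ge> ereal (\<bar>l\<bar> powr (-q))"
proof -
  let ?e = "\<lambda>s::real. 4 * s * (s powr (-q) + 2) powr (\<alpha>/2) * sqrt (1 + ln (s powr (-q) + 2))"
  have "q * \<alpha> < 2" using \<alpha> q by (simp add: field_simps)
  \<comment> \<open>The room \<open>1/2 - \<epsilon>\<close> comes from the median bound.\<close>
  hence "\<forall>\<^sub>F s in at_right 0. ?e s < 1/2 - \<epsilon>"
    using crossing_error_tendsto_0[OF \<alpha>(1) q(1)] \<epsilon> by (intro order_tendstoD) auto
  hence "\<forall>\<^sub>F l in at_left 0. ?e (- l) < 1/2 - \<epsilon>"
    by (subst at_left_minus) (simp add: eventually_filtermap)
  moreover have "\<forall>\<^sub>F l in at_left (0::real). l < 0"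
    by (simp add: eventually_at_filter)
  ultimately show ?thesis
  proof eventually_elim
    case (elim l)
    show ?case unfolding xi_def
    proof (rule Inf_greatest, clarify)
      fix R assume R: "R \<ge> 0" "measure (completion M) (Cross M f l R) < \<epsilon>"
      show "ereal (\<bar>l\<bar> powr (-q)) \<le> ereal R"
      proof (rule ccontr)
        assume "\<not> ?thesis"
        hence RX: "R < \<bar>l\<bar> powr (-q)" by simp
        have "4 * \<bar>l\<bar> * (R + 2) powr (\<alpha>/2) * sqrt (1 + ln (R + 2)) \<le> ?e \<bar>l\<bar>"
          using RX R(1) \<alpha> by (intro mult_mono powr_mono2 real_sqrt_le_mono add_mono mult_nonneg_nonneg) auto
        moreover have "?e \<bar>l\<bar> < 1/2 - \<epsilon>" using elim by simp
        ultimately have "measure (completion M) (Cross M f l R) > \<epsilon>"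
          using prob_Cross_lower_bound[OF \<alpha> R(1) less_imp_le[OF elim(2)]] by linarith
        thus False using R(2) by simp
      qed
    qed
  qed
qed

lemma ln_ereal_quotient_ge:
  assumes \<xi>: "\<xi> \<ge> ereal (\<bar>l\<bar> powr (-q))" and l: "-1 < l" "l < 0"
  shows "- ln_ereal \<xi> / ereal (ln \<bar>l\<bar>) \<ge> ereal q"
proof -
  have ln: "ln \<bar>l\<bar> < 0" using l by simp
  have "\<xi> > 0"
  proof -
    have "0 < ereal (\<bar>l\<bar> powr (-q))" using l by simp
    thus ?thesis using \<xi> by (rule less_le_trans)
  qed
  then consider "\<xi> = \<infinity>" | x where "\<xi> = ereal x" "x > 0" by (cases \<xi>) auto
  thus ?thesis
  proof cases
    case 1
    thus ?thesis using ln by (simp add: ln_ereal_def divide_ereal_def)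
  next
    case 2
    have "ln (\<bar>l\<bar> powr (-q)) \<le> ln x" using \<xi> 2 l by (subst ln_le_cancel_iff) auto
    hence "- q * ln \<bar>l\<bar> \<le> ln x" using l by (simp add: ln_powr)
    hence "q \<le> - ln x / ln \<bar>l\<bar>" using ln by (simp add: field_simps)
    thus ?thesis using 2 ln by (simp add: ln_ereal_def)
  qed
qed

theorem proposition1p6:
  fixes M :: "'w measure" and f :: "real^2 \<Rightarrow> 'w \<Rightarrow> real" and \<alpha> \<epsilon> :: real
  assumes "prob_space M"
    and "0 < \<alpha>" and "\<alpha> \<le> 1"
    and "gaussian_field M f" and "centred_field M f" and "smooth_field M f"
    and "stationary_field M f" and "isotropic_field M f"
    and "\<And>x. (LINT \<omega>|M. f 0 \<omega> * f x \<omega>) = cauchy_kernel \<alpha> x"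
    and "0 < \<epsilon>" and "\<epsilon> < 1 / (2 * exp 1)"
  shows "Liminf (at_left 0) (\<lambda>l :: real. - ln_ereal (xi M f \<epsilon> l) / ereal (ln \<bar>l\<bar>)) \<ge> ereal (2 / \<alpha>)
    \<and> (\<forall>\<nu> :: real.
        (\<exists>\<delta> :: real \<Rightarrow> real. (\<delta> \<longlongrightarrow> 0) (at_left 0) \<and>
           (\<forall>\<^sub>F l in at_left 0. xi M f \<epsilon> l = ereal (\<bar>l\<bar> powr (- \<nu> + \<delta> l))))
        \<longrightarrow> \<nu> \<ge> 2 / \<alpha>)"
proof -
  interpret prob_space M by fact
  have meas: "f x \<in> borel_measurable M" for x
    using assms(4)[unfolded gaussian_field_def, rule_format, of "{x}" "\<lambda>_. 1"]
    by (simp add: gaussian_rv_def)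
  \<comment> \<open>Stationarity turns the covariances with \<open>f 0\<close> into all covariances.\<close>
  have cov: "expectation (\<lambda>\<omega>. f x \<omega> * f y \<omega>) = cauchy_kernel \<alpha> (y - x)" for x y
  proof -
    let ?P = "\<Pi>\<^sub>M x\<in>(UNIV :: (real^2) set). (borel :: real measure)"
    let ?g = "\<lambda>u :: real^2 \<Rightarrow> real. u 0 * u (y - x)"
    have g: "?g \<in> borel_measurable ?P" by (intro borel_measurable_times measurable_component_singleton) auto
    have m: "(\<lambda>\<omega> z. h z \<omega>) \<in> measurable M ?P" if "\<And>z. h z \<in> borel_measurable M" for h
      by (rule measurable_PiM_single') (use that in auto)
    have "expectation (\<lambda>\<omega>. f x \<omega> * f y \<omega>) = (LINT u|field_law M (\<lambda>z. f (z + x)). ?g u)"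
      unfolding field_law_def by (subst integral_distr[OF m g]) (auto intro: meas)
    also have "field_law M (\<lambda>z. f (z + x)) = field_law M f"
      using assms(7) by (simp add: stationary_field_def)
    also have "(LINT u|field_law M f. ?g u) = expectation (\<lambda>\<omega>. f 0 \<omega> * f (y - x) \<omega>)"
      unfolding field_law_def by (subst integral_distr[OF m g]) (auto intro: meas)
    finally show ?thesis by (simp add: assms(9))
  qed
  have cont: "AE \<omega> in M. continuous_on UNIV (\<lambda>x. f x \<omega>)"
    using assms(6) unfolding smooth_field_def by eventually_elim (metis Ck.simps(1))
  interpret cauchy_field M f \<alpha>
    by unfold_locales (fact assms(4) assms(5) cov cont)+
  have "2 * exp (1::real) \<ge> 2" using one_le_exp_iff[of "1::real"] by simp
  hence "1 / (2 * exp (1::real)) \<le> 1 / 2" by (intro divide_left_mono) auto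
  hence \<epsilon>: "\<epsilon> < 1/2" using assms(11) by linarith
  let ?Q = "\<lambda>l. - ln_ereal (xi M f \<epsilon> l) / ereal (ln \<bar>l\<bar>)"
  have near: "\<forall>\<^sub>F l in at_left (0::real). -1 < l \<and> l < 0"
    using eventually_at_left_real[of "-1" "0::real"] by (auto elim: eventually_mono)
  have ev: "\<forall>\<^sub>F l in at_left 0. ereal q \<le> ?Q l" if "0 < q" "q < 2 / \<alpha>" for q
    using eventually_xi_ge[OF assms(2,3) that \<epsilon>] near
  proof eventually_elim
    case (elim l)
    thus ?case by (intro ln_ereal_quotient_ge) blast+
  qed
  have liminf: "ereal (2 / \<alpha>) \<le> Liminf (at_left 0) ?Q"
    unfolding le_Liminf_iff
  proof (intro allI impI)
    fix y :: ereal assume "y < ereal (2 / \<alpha>)"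
    hence "max y 0 < ereal (2 / \<alpha>)" using assms(2) by simp
    then obtain q where q: "max y 0 < ereal q" "ereal q < ereal (2 / \<alpha>)"
      using ereal_dense2 by blast
    hence "\<forall>\<^sub>F l in at_left 0. ereal q \<le> ?Q l" by (intro ev) auto
    thus "\<forall>\<^sub>F l in at_left 0. y < ?Q l"
      by eventually_elim (use q in \<open>auto intro: less_le_trans\<close>)
  qed
  have "\<nu> \<ge> 2 / \<alpha>" if \<delta>: "(\<delta> \<longlongrightarrow> 0) (at_left 0)"
    and xi: "\<forall>\<^sub>F l in at_left 0. xi M f \<epsilon> l = ereal (\<bar>l\<bar> powr (- \<nu> + \<delta> l))" for \<nu> \<delta>
  proof -
    have "\<forall>\<^sub>F l in at_left 0. ?Q l = ereal (\<nu> - \<delta> l)"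
      using xi near
    proof eventually_elim
      case (elim l)
      have "ln \<bar>l\<bar> \<noteq> 0" "\<bar>l\<bar> powr (- \<nu> + \<delta> l) > 0" using elim by auto
      thus ?case using elim by (simp add: ln_ereal_def ln_powr field_simps)
    qed
    moreover have "((\<lambda>l. ereal (\<nu> - \<delta> l)) \<longlongrightarrow> ereal (\<nu> - 0)) (at_left 0)"
      by (intro tendsto_intros \<delta>)
    ultimately have "(?Q \<longlongrightarrow> ereal \<nu>) (at_left 0)"
      by (subst tendsto_cong) auto
    hence "Liminf (at_left 0) ?Q = ereal \<nu>" by (rule lim_imp_Liminf[rotated]) simp
    thus ?thesis using liminf by simp
  qed
  thus ?thesis using liminf by blast
qed

end
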